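(* Let $\mathcal{H}$ be an infinite-dimensional separable Hilbert space (real or complex). There exist a nested sequence $V_1\subseteq V_2\subseteq V_3\subseteq\cdots$ of finite-dimensional linear subspaces of $\mathcal{H}$ with $\dim(V_m)=m$ for all $m\in\mathbb{N}$, a frame $\Phi=(\varphi_n)_{n\in\mathbb{N}}$ of $\mathcal{H}$, and an increasing function $G:\mathbb{N}\to(0,\infty)$ satisfying, for every $m\in\mathbb{N}$, $$\inf_{|\alpha|=1}\|f-\alpha g\|_{\mathcal{H}}\leq G(m)\,\|\mathcal{A}_\Phi(f)-\mathcal{A}_\Phi(g)\|_{\ell_2}\qquad\text{for all } f,g\in V_m,$$ such that the following holds. For $\gamma>1$ and $R>0$ define $$\mathcal{B}_\gamma(R)=\{f\in\mathcal{H}:\ \|f-P_mf\|\leq G(m+1)^{-\gamma}R\|f\|\ \text{ for every } m\in\mathbb{N}\},$$ where $P_m$ denotes the orthogonal projection of $\mathcal{H}$ onto $V_m$. Then for every $\gamma>1$, $R>0$, $\sigma>1+\gamma$ and $C>0$ there exist $f,g\in\mathcal{B}_\gamma(R)$ with $$\inf_{|\alpha|=1}\|f-\alpha g\|_{\mathcal{H}}> C\left(\|f\|_{\mathcal{H}}+\|g\|_{\mathcal{H}}\right)^{\frac{1}{\sigma}}\|\mathcal{A}_\Phi(f)-\mathcal{A}_\Phi(g)\|_{\ell_2}^{\frac{\sigma-1}{\sigma}}.$$ In particular, for every $\gamma>1$ and $R>0$, the frame $\Phi$ fails to do Lipschitz stable phase retrieval on $\mathcal{B}_\gamma(R)$,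 and even fails to do $(\sigma-1)/\sigma$-H\"older stable phase retrieval on $\mathcal{B}_\gamma(R)$ for any $\sigma>1+\gamma$.
   Context: A frame of a separable Hilbert space $\mathcal{H}$ is a (countable) family $\Phi=(\varphi_n)_{n\in I}$ in $\mathcal{H}$ for which there are constants $A,B>0$ with $A\|f\|^2\leq\sum_{n\in I}|\langle f,\varphi_n\rangle|^2\leq B\|f\|^2$ for all $f\in\mathcal{H}$. Its intensity measurement map is $\mathcal{A}_\Phi(f)=(|\langle f,\varphi_n\rangle|)_{n\in I}\in\ell_2(I)$. The infimum $\inf_{|\alpha|=1}$ is over scalars $\alpha$ of modulus one in the scalar field of $\mathcal{H}$ ($\alpha=\pm1$ in the real case). For $0<\mu\leq1$, $\Phi$ does $\mu$-H\"older stable phase retrieval on a subset $\mathcal{B}\subseteq\mathcal{H}$ if there is a constant $K$ such that $\inf_{|\alpha|=1}\|f-\alpha g\|_{\mathcal{H}}\leq K(\|f\|_{\mathcal{H}}+\|g\|_{\mathcal{H}})^{1-\mu}\|\mathcal{A}_\Phi(f)-\mathcal{A}_\Phi(g)\|_{\ell_2}^{\mu}$ for all $f,g\in\mathcal{B}$. Lipschitz stable phase retrieval on $\mathcal{B}$ is the case $\mu=1$. *)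

theory Defs
  imports "HOL-Analysis.Analysis"
begin

(* The scalar fields: the real and the complex numbers. The axioms admit nothing else, see
   rc_scalar_cases below. *)
class rc_scalar = real_normed_field +
  fixes scalar_cnj :: "'a \<Rightarrow> 'a"
  assumes scalar_cnj_add: "scalar_cnj (x + y) = scalar_cnj x + scalar_cnj y"
    and mult_scalar_cnj_scaleR: "x * scalar_cnj x = (norm x)\<^sup>2 *\<^sub>R 1"

lemma mult_scalar_cnj: "(x::'k::rc_scalar) * scalar_cnj x = of_real ((norm x)\<^sup>2)"
  by (simp add: mult_scalar_cnj_scaleR of_real_def)

instantiation real :: rc_scalar
begin
definition scalar_cnj_real :: "real \<Rightarrow> real" where "scalar_cnj_real x = x"
instance
  by standard (simp_all add: scalar_cnj_real_def power2_eq_square)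
end

instantiation complex :: rc_scalar
begin
definition scalar_cnj_complex :: "complex \<Rightarrow> complex" where "scalar_cnj_complex = cnj"
instance
  by standard (simp_all add: scalar_cnj_complex_def scaleR_conv_of_real complex_norm_square
      del: of_real_power)
end

lemma scalar_cnj_of_real: "scalar_cnj (of_real r :: 'k::rc_scalar) = of_real r"
proof (cases "r = 0")
  case True
  have "scalar_cnj (0 + 0 :: 'k) = scalar_cnj 0 + scalar_cnj 0" by (rule scalar_cnj_add)
  then show ?thesis using True by simp
next
  case False
  have "of_real r * scalar_cnj (of_real r :: 'k) = of_real r * of_real r"
    using mult_scalar_cnj[of "of_real r :: 'k"] by (simp add: power2_eq_square)
  then show ?thesis using False by simp
qed

lemma add_scalar_cnj_in_Reals: "x + scalar_cnj x \<in> (\<real> :: 'k::rc_scalar set)"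
proof -
  have "(1 + x) * scalar_cnj (1 + x) = 1 + (x + scalar_cnj x) + x * scalar_cnj x"
    using scalar_cnj_of_real[of 1, where 'k = 'k] by (simp add: scalar_cnj_add algebra_simps)
  then have "x + scalar_cnj x = of_real ((norm (1 + x))\<^sup>2 - 1 - (norm x)\<^sup>2)"
    by (simp add: mult_scalar_cnj algebra_simps)
  then show ?thesis by (simp only: Reals_of_real)
qed

lemma rc_scalar_decomp:
  fixes z :: "'k::rc_scalar"
  obtains a b and u :: 'k where "z = of_real a + of_real b * u"
    and "scalar_cnj z = of_real a - of_real b * u" and "b = 0 \<or> u * u = - 1"
proof -
  obtain s where s: "z + scalar_cnj z = of_real s"
    using add_scalar_cnj_in_Reals[of z] by (auto elim: Reals_cases)
  define a where "a = s / 2"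
  define w where "w = z - of_real a"
  have z: "z = of_real a + w" and cz: "scalar_cnj z = of_real a - w"
    using s by (simp_all add: w_def a_def algebra_simps)
  have "(of_real a + w) * (of_real a - w) = of_real ((norm z)\<^sup>2)"
    using mult_scalar_cnj[of z] z cz by simp
  then have ww: "w * w = of_real (a\<^sup>2 - (norm z)\<^sup>2)"
    by (simp add: algebra_simps power2_eq_square)
  show thesis
  proof (cases "w = 0")
    case True
    then show thesis using that[of a 0 0] z cz by simp
  next
    case False
    have "(norm z)\<^sup>2 \<ge> a\<^sup>2"
    proof -
      have "norm (scalar_cnj z) = norm z"
      proof (cases "z = 0")
        case True
        then show ?thesis using scalar_cnj_of_real[of 0, where 'k = 'k] by simp
      next
        case False
        have "norm z * norm (scalar_cnj z) = norm z * norm z"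
          using arg_cong[OF mult_scalar_cnj[of z], of norm]
          by (simp add: norm_mult power2_eq_square)
        then show ?thesis using False by simp
      qed
      then have "\<bar>s\<bar> \<le> 2 * norm z"
        using norm_triangle_ineq[of z "scalar_cnj z"] s by simp
      then have "\<bar>a\<bar> \<le> norm z" by (simp add: a_def)
      then show ?thesis by (metis abs_le_square_iff abs_norm_cancel)
    qed
    moreover have "w * w \<noteq> 0" using False by simp
    ultimately have pos: "(norm z)\<^sup>2 - a\<^sup>2 > 0" using ww by (cases "(norm z)\<^sup>2 = a\<^sup>2") auto
    define b where "b = sqrt ((norm z)\<^sup>2 - a\<^sup>2)"
    have b: "b > 0" "b * b = (norm z)\<^sup>2 - a\<^sup>2" using pos by (simp_all add: b_def)
    have "of_real (b * b) = (- (w * w) :: 'k)" using ww b by simp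
    then have "(w / of_real b) * (w / of_real b) = - 1"
      using b(1) False by (simp add: field_simps)
    then show thesis using that[of a b "w / of_real b"] z cz b(1) by simp
  qed
qed

lemma rc_scalar_cases:
  obtains (real) "\<And>z::'k::rc_scalar. z \<in> \<real> \<and> scalar_cnj z = z"
  | (complex) i :: "'k::rc_scalar" where "i * i = - 1"
      and "\<And>z. \<exists>a b. z = of_real a + of_real b * i \<and> scalar_cnj z = of_real a - of_real b * i"
proof (cases "\<exists>i::'k. i * i = - 1")
  case True
  then obtain i :: 'k where i: "i * i = - 1" by blast
  have "\<exists>a b. z = of_real a + of_real b * i \<and> scalar_cnj z = of_real a - of_real b * i" for z
  proof -
    obtain a b and u :: 'k where u: "z = of_real a + of_real b * u"
      "scalar_cnj z = of_real a - of_real b * u" "b = 0 \<or> u * u = - 1"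
      by (rule rc_scalar_decomp)
    show ?thesis
    proof (cases "b = 0")
      case True
      then show ?thesis using u by (intro exI[of _ a] exI[of _ 0]) simp
    next
      case False
      then have "(u - i) * (u + i) = 0" using u(3) i by (simp add: algebra_simps)
      then have "u = i \<or> u = - i" by (auto simp: add_eq_0_iff2)
      then show ?thesis
      proof
        assume "u = i"
        then show ?thesis using u by blast
      next
        assume "u = - i"
        then show ?thesis using u by (intro exI[of _ a] exI[of _ "- b"]) simp
      qed
    qed
  qed
  then show thesis using that(2) i by blast
next
  case False
  have "z \<in> \<real> \<and> scalar_cnj z = z" for z :: 'k
  proof -
    obtain a b and u :: 'k where "z = of_real a + of_real b * u"
      "scalar_cnj z = of_real a - of_real b * u" "b = 0 \<or> u * u = - 1"
      by (rule rc_scalar_decomp)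
    then show ?thesis using False by auto
  qed
  then show thesis by (rule that(1))
qed

(* The inner product is linear in its first argument. The norm and completeness are those of the
   type 'h, whose real scalar multiplication is the restriction of smul. *)
locale hilbert_space = vector_space smul
  for smul :: "'k::rc_scalar \<Rightarrow> 'h::banach \<Rightarrow> 'h" +
  fixes ip :: "'h \<Rightarrow> 'h \<Rightarrow> 'k"
  assumes smul_of_real: "smul (of_real r) x = r *\<^sub>R x"
    and ip_add_left: "ip (x + y) z = ip x z + ip y z"
    and ip_smul_left: "ip (smul c x) y = c * ip x y"
    and ip_commute: "ip y x = scalar_cnj (ip x y)"
    and ip_self: "ip x x = of_real ((norm x)\<^sup>2)"

lemma hilbert_space_real:
  "hilbert_space scaleR (inner :: 'a::{real_inner, banach} \<Rightarrow> 'a \<Rightarrow> real)"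
  by unfold_locales
    (simp_all add: algebra_simps inner_commute scalar_cnj_real_def power2_norm_eq_inner)

lemma hilbert_space_complex: "hilbert_space (*) (\<lambda>x y :: complex. x * cnj y)"
  by unfold_locales
    (simp_all add: algebra_simps scaleR_conv_of_real scalar_cnj_complex_def complex_norm_square
      del: of_real_power)

definition is_frame :: "('h::banach \<Rightarrow> 'h \<Rightarrow> 'k::rc_scalar) \<Rightarrow> 'i set \<Rightarrow> ('i \<Rightarrow> 'h) \<Rightarrow> bool"
  where "is_frame ip I \<phi> \<longleftrightarrow> countable I \<and>
    (\<exists>A>0. \<exists>B>0. \<forall>f.
      (\<lambda>n. (norm (ip f (\<phi> n)))\<^sup>2) summable_on I \<and>
      A * (norm f)\<^sup>2 \<le> (\<Sum>\<^sub>\<infinity>n\<in>I. (norm (ip f (\<phi> n)))\<^sup>2) \<and>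
      (\<Sum>\<^sub>\<infinity>n\<in>I. (norm (ip f (\<phi> n)))\<^sup>2) \<le> B * (norm f)\<^sup>2)"

definition intensity :: "('h::banach \<Rightarrow> 'h \<Rightarrow> 'k::rc_scalar) \<Rightarrow> ('i \<Rightarrow> 'h) \<Rightarrow> 'h \<Rightarrow> 'i \<Rightarrow> real"
  where "intensity ip \<phi> f = (\<lambda>n. norm (ip f (\<phi> n)))"

(* Meaningful for square-summable families only; for a frame, all values of the intensity map and
   their differences are square-summable. *)
definition l2_norm :: "'i set \<Rightarrow> ('i \<Rightarrow> real) \<Rightarrow> real"
  where "l2_norm I x = sqrt (\<Sum>\<^sub>\<infinity>n\<in>I. (x n)\<^sup>2)"

definition intensity_dist ::
    "('h::banach \<Rightarrow> 'h \<Rightarrow> 'k::rc_scalar) \<Rightarrow> 'i set \<Rightarrow> ('i \<Rightarrow> 'h) \<Rightarrow> 'h \<Rightarrow> 'h \<Rightarrow> real"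
  where "intensity_dist ip I \<phi> f g =
    l2_norm I (\<lambda>n. intensity ip \<phi> f n - intensity ip \<phi> g n)"

definition phase_dist :: "('k::rc_scalar \<Rightarrow> 'h::banach \<Rightarrow> 'h) \<Rightarrow> 'h \<Rightarrow> 'h \<Rightarrow> real"
  where "phase_dist smul f g = (INF \<alpha>\<in>{\<alpha>. norm \<alpha> = 1}. norm (f - smul \<alpha> g))"

(* Used for 0 < mu <= 1. Since 0 powr 0 = 0, for mu = 1 and f = g = 0 the right-hand side is 0; it
   would be 0 with 0 powr 0 = 1 as well, because of the last factor. *)
definition holder_stable_phase_retrieval ::
    "('k::rc_scalar \<Rightarrow> 'h::banach \<Rightarrow> 'h) \<Rightarrow> ('h \<Rightarrow> 'h \<Rightarrow> 'k) \<Rightarrow> 'i set \<Rightarrow> ('i \<Rightarrow> 'h) \<Rightarrow>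
      real \<Rightarrow> 'h set \<Rightarrow> bool"
  where "holder_stable_phase_retrieval smul ip I \<phi> \<mu> S \<longleftrightarrow>
    (\<exists>K. \<forall>f\<in>S. \<forall>g\<in>S.
      phase_dist smul f g
        \<le> K * (norm f + norm g) powr (1 - \<mu>) * intensity_dist ip I \<phi> f g powr \<mu>)"

definition lipschitz_stable_phase_retrieval ::
    "('k::rc_scalar \<Rightarrow> 'h::banach \<Rightarrow> 'h) \<Rightarrow> ('h \<Rightarrow> 'h \<Rightarrow> 'k) \<Rightarrow> 'i set \<Rightarrow> ('i \<Rightarrow> 'h) \<Rightarrow>
      'h set \<Rightarrow> bool"
  where "lipschitz_stable_phase_retrieval smul ip I \<phi> S \<longleftrightarrow>
    holder_stable_phase_retrieval smul ip I \<phi> 1 S"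

(* Well defined for finite-dimensional (more generally, complete) subspaces V. *)
definition orth_proj :: "('h::banach \<Rightarrow> 'h \<Rightarrow> 'k::rc_scalar) \<Rightarrow> 'h set \<Rightarrow> 'h \<Rightarrow> 'h"
  where "orth_proj ip V f = (THE p. p \<in> V \<and> (\<forall>v\<in>V. ip (f - p) v = 0))"

(* The natural numbers start at 1: V 0 and G 0 play no role. *)
definition approx_class ::
    "('h::banach \<Rightarrow> 'h \<Rightarrow> 'k::rc_scalar) \<Rightarrow> (nat \<Rightarrow> 'h set) \<Rightarrow> (nat \<Rightarrow> real) \<Rightarrow>
      real \<Rightarrow> real \<Rightarrow> 'h set"
  where "approx_class ip V G \<gamma> R =
    {f. \<forall>m\<ge>1. norm (f - orth_proj ip (V m) f) \<le> G (m + 1) powr (- \<gamma>) * R * norm f}"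

end

(* Take an orthonormal basis e_0, e_1, ... and V_m = span {e_0, ..., e_(m-1)}. The frame consists of
   the basis together with the vectors 2^(-max j k) (e_j + v e_k), v = 1 or conj u, where u = 1 over
   the reals and u = i over the complex numbers. The basis alone gives the frame bounds. On V_m, the
   weights being at least 2^(-m), polarization recovers the products f_j conj f_k stably, so
   G(m) = 9 m 2^m is a stability constant. Conversely, e_0 + eps e_n and e_0 - eps e_n have distance at
   least eps up to a phase, but only the four frame vectors coupling e_0 and e_n tell them apart, so
   their intensities differ by at most 4 eps 2^(-n). With eps of order G(n+1)^(-gamma) both vectors lie
   in the approximation class, and for sigma > 1 + gamma the Hoelder bound fails as n grows. *)

theory Submission
  imports Defs "HOL-Real_Asymp.Real_Asymp"
begin

section \<open>Scalars and orthonormal systems\<close>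

text \<open>The weights have to serve two purposes. Their squares must be summable over all pairs,
  to keep the upper frame bound, and the coupling of \<open>e 0\<close> with \<open>e n\<close> must
  be about as weak as the weakest coupling inside \<open>initial_span (n + 1)\<close>. Weights
  2^(-j-k) would miss the second aim: they would give G(m) of order 4^m up to a factor linear in m,
  while \<open>e 0\<close> and \<open>e n\<close> would still be coupled with strength 2^(-n), about
  G^(-1/2), and the argument would only reach \<sigma> > 1 + 2 \<gamma>. With 2^(-max j k) the
  intensity distance is at most \<epsilon> / G(n+1) times a factor linear in n. The Hoelder bound
  then compares \<epsilon> with (\<epsilon> / G)^(1 - 1/\<sigma>); for \<epsilon> of order
  G^(-\<gamma>) this amounts to comparing \<gamma> with \<sigma> - 1, and this is the origin of the
  threshold.\<close>

lemma scalar_cnj_eq: "scalar_cnj z = of_real ((norm z)\<^sup>2) / (z :: 'k::rc_scalar)"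
proof (cases "z = 0")
  case True
  then show ?thesis using scalar_cnj_of_real[of 0, where 'k = 'k] by simp
next
  case False
  then show ?thesis using mult_scalar_cnj[of z] by (simp add: field_simps)
qed

lemma norm_scalar_cnj [simp]: "norm (scalar_cnj z) = norm (z :: 'k::rc_scalar)"
  by (simp add: scalar_cnj_eq norm_divide norm_mult power2_eq_square)

lemma scalar_cnj_scalar_cnj [simp]: "scalar_cnj (scalar_cnj z) = (z :: 'k::rc_scalar)"
  by (cases "z = 0") (simp_all add: scalar_cnj_eq[of "scalar_cnj z"], simp_all add: scalar_cnj_eq)

text \<open>Multiplicativity is not among the class axioms; the closed form
  \<open>scalar_cnj_eq\<close> inherits it from the norm.\<close>

lemma scalar_cnj_mult: "scalar_cnj (w * z) = scalar_cnj w * scalar_cnj (z :: 'k::rc_scalar)"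
  by (simp only: scalar_cnj_eq norm_mult power_mult_distrib of_real_mult times_divide_times_eq)

lemma scalar_cnj_eq_0_iff [simp]: "scalar_cnj z = 0 \<longleftrightarrow> z = (0 :: 'k::rc_scalar)"
  by (metis norm_scalar_cnj norm_eq_zero)

lemma scalar_cnj_1 [simp]: "scalar_cnj 1 = (1 :: 'k::rc_scalar)"
  by (simp add: scalar_cnj_eq)

lemma scalar_cnj_minus: "scalar_cnj (- z) = - scalar_cnj (z :: 'k::rc_scalar)"
  by (simp add: scalar_cnj_eq)

lemma scalar_cnj_diff: "scalar_cnj (w - z) = scalar_cnj w - scalar_cnj (z :: 'k::rc_scalar)"
  by (metis scalar_cnj_add scalar_cnj_minus diff_conv_add_uminus)

text \<open>The last bracket is twice the real part of \<open>x * scalar_cnj y\<close>, written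
  without a real-part operation so that one identity serves both fields.\<close>

lemma norm_sq_add_scalar:
  fixes x y :: "'k::rc_scalar"
  shows "of_real ((norm (x + y))\<^sup>2) =
    of_real ((norm x)\<^sup>2) + of_real ((norm y)\<^sup>2) + (x * scalar_cnj y + scalar_cnj (x * scalar_cnj y))"
  unfolding mult_scalar_cnj[symmetric] by (simp add: scalar_cnj_add scalar_cnj_mult algebra_simps)

text \<open>The two summands are twice the moduli of the real parts of \<open>z\<close> and
  \<open>u * z\<close>. Over the reals the first one suffices, with \<open>u = 1\<close>; over the
  complex numbers \<open>u = i\<close> makes the second one measure the imaginary part.\<close>

lemma polarizing_unit_exists:
  "\<exists>u :: 'k::rc_scalar. norm u = 1 \<and>
    (\<forall>z. 2 * norm z \<le> norm (z + scalar_cnj z) + norm (u * z + scalar_cnj (u * z)))"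
proof (rule rc_scalar_cases[where 'k = 'k])
  assume "\<And>z::'k. z \<in> \<real> \<and> scalar_cnj z = z"
  then have "scalar_cnj z = z" for z :: 'k by blast
  then have "2 * norm z \<le> norm (z + scalar_cnj z)" for z :: 'k
    by (simp add: norm_mult flip: mult_2)
  then have "2 * norm z \<le> norm (z + scalar_cnj z) + norm (1 * z + scalar_cnj (1 * z))" for z :: 'k
    by (rule order_trans) simp
  then show ?thesis using norm_one by blast
next
  fix i :: 'k
  assume i: "i * i = - 1"
    "\<And>z. \<exists>a b. z = of_real a + of_real b * i \<and> scalar_cnj z = of_real a - of_real b * i"
  have "norm i * norm i = 1" using arg_cong[OF i(1), of norm] by (simp add: norm_mult)
  then have n: "norm i = 1" using square_eq_1_iff[of "norm i"] norm_ge_zero[of i] by auto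
  have c: "scalar_cnj i = - i"
    using i(1) n inverse_unique[of i "- i"] by (simp add: scalar_cnj_eq divide_inverse)
  have "2 * norm z \<le> norm (z + scalar_cnj z) + norm (i * z + scalar_cnj (i * z))" for z
  proof -
    have "i * (i * w) = - w" for w by (simp add: i(1) flip: mult.assoc)
    \<comment> \<open>Splitting into real and imaginary part: the second bracket is minus twice the
      imaginary part of \<open>z\<close>.\<close>
    then have "2 * z = (z + scalar_cnj z) - i * (i * z + scalar_cnj (i * z))"
      by (simp add: scalar_cnj_mult c right_diff_distrib)
    then have "norm (2 * z) \<le> norm (z + scalar_cnj z) + norm (i * (i * z + scalar_cnj (i * z)))"
      by (metis norm_triangle_ineq4)
    then show ?thesis by (simp add: norm_mult n)
  qed
  then show ?thesis using n by blast
qed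

section \<open>Orthonormal families and the existence of an orthonormal basis\<close>

context hilbert_space
begin

lemma ip_zero_left [simp]: "ip 0 y = 0"
  using ip_add_left[of 0 0 y] by simp

lemma ip_zero_right [simp]: "ip x 0 = 0"
  using ip_commute[of x 0] by simp

lemma ip_add_right: "ip x (y + z) = ip x y + ip x z"
  using ip_commute[of x "y + z"] ip_commute[of x y] ip_commute[of x z]
  by (metis ip_add_left ip_commute scalar_cnj_add)

lemma ip_smul_right: "ip x (smul c y) = scalar_cnj c * ip x y"
  by (metis ip_smul_left ip_commute scalar_cnj_mult)

lemma ip_eq_0_commute: "ip x y = 0 \<longleftrightarrow> ip y x = 0"
  by (metis ip_commute scalar_cnj_eq_0_iff)

lemma ip_minus_left: "ip (- x) y = - ip x y"
  using ip_add_left[of x "- x" y] by (simp add: eq_neg_iff_add_eq_0 add.commute)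

lemma ip_diff_left: "ip (x - y) z = ip x z - ip y z"
  using ip_add_left[of x "- y" z] by (simp add: ip_minus_left)

lemma ip_sum_left: "ip (\<Sum>j\<in>A. f j) y = (\<Sum>j\<in>A. ip (f j) y)"
  by (induction A rule: infinite_finite_induct) (simp_all add: ip_add_left)

lemma norm_smul: "norm (smul c x) = norm c * norm x"
proof -
  have "of_real ((norm (smul c x))\<^sup>2) = c * scalar_cnj c * ip x x"
    by (simp add: ip_self[symmetric] ip_smul_left ip_smul_right del: of_real_power)
  also have "\<dots> = of_real ((norm c * norm x)\<^sup>2)"
    by (simp add: mult_scalar_cnj ip_self power_mult_distrib)
  finally have "(norm (smul c x))\<^sup>2 = (norm c * norm x)\<^sup>2"
    by (simp only: of_real_eq_iff)
  then show ?thesis by (simp add: power2_eq_iff_nonneg)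
qed

lemma pythagoras:
  assumes "ip x y = 0"
  shows "(norm (x + y))\<^sup>2 = (norm x)\<^sup>2 + (norm y)\<^sup>2"
proof -
  have "ip y x = 0" using assms ip_eq_0_commute by blast
  then have "ip (x + y) (x + y) = ip x x + ip y y"
    using assms by (simp add: ip_add_left ip_add_right)
  then have "of_real ((norm (x + y))\<^sup>2) = (of_real ((norm x)\<^sup>2 + (norm y)\<^sup>2) :: 'k)"
    by (simp only: ip_self of_real_add)
  then show ?thesis by (simp only: of_real_eq_iff)
qed

lemma cauchy_schwarz: "norm (ip x y) \<le> norm x * norm y"
proof (cases "y = 0")
  case False
  define c where "c = ip x y / of_real ((norm y)\<^sup>2)"
  have "ip (x - smul c y) y = 0"
    using False by (simp add: ip_diff_left ip_smul_left c_def ip_self)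
  then have "ip (x - smul c y) (smul c y) = 0" by (simp add: ip_smul_right)
  from pythagoras[OF this] have "(norm (smul c y))\<^sup>2 \<le> (norm x)\<^sup>2" by simp
  then have "norm c * norm y \<le> norm x" by (simp add: norm_smul power2_le_iff_abs_le)
  moreover have "norm c * norm y = norm (ip x y) / norm y"
    using False by (simp add: c_def norm_divide norm_mult power2_eq_square)
  ultimately show ?thesis using False by (simp add: divide_le_eq)
qed simp

text \<open>Indexed families cover sequences and, with the identity as family, also plain sets of
  vectors, to which Zorn's lemma is applied.\<close>

definition orthonormal :: "('i \<Rightarrow> 'h) \<Rightarrow> 'i set \<Rightarrow> bool"
  where "orthonormal e A \<longleftrightarrow> (\<forall>i\<in>A. \<forall>j\<in>A. ip (e i) (e j) = of_bool (i = j))"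

lemma orthonormal_norm: "orthonormal e A \<Longrightarrow> i \<in> A \<Longrightarrow> norm (e i) = 1"
  using ip_self[of "e i"] norm_ge_zero[of "e i"] power2_eq_1_iff[of "norm (e i)"]
  by (auto simp: orthonormal_def simp flip: of_real_power simp del: norm_ge_zero)

lemma orthonormal_subset: "orthonormal e A \<Longrightarrow> B \<subseteq> A \<Longrightarrow> orthonormal e B"
  unfolding orthonormal_def by blast

lemma orthonormal_inj_on: "orthonormal e A \<Longrightarrow> inj_on e A"
  unfolding orthonormal_def inj_on_def by (metis of_bool_eq(1) of_bool_eq(2) zero_neq_one)

lemma ip_combination:
  assumes "finite B" "orthonormal e A" "B \<subseteq> A" "i \<in> A"
  shows "ip (\<Sum>j\<in>B. smul (c j) (e j)) (e i) = (if i \<in> B then c i else 0)"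
proof -
  have "ip (\<Sum>j\<in>B. smul (c j) (e j)) (e i) = (\<Sum>j\<in>B. if j = i then c j else 0)"
    unfolding ip_sum_left using assms(2-4)
    by (intro sum.cong) (auto simp: ip_smul_left orthonormal_def)
  then show ?thesis using assms(1) by (simp add: sum.delta')
qed

lemma norm_combination:
  assumes "finite A" "orthonormal e A"
  shows "(norm (\<Sum>j\<in>A. smul (c j) (e j)))\<^sup>2 = (\<Sum>j\<in>A. (norm (c j))\<^sup>2)"
  using assms
proof (induction A rule: finite_induct)
  case (insert x F)
  have "ip (\<Sum>j\<in>F. smul (c j) (e j)) (e x) = 0"
    using ip_combination[OF insert.hyps(1) insert.prems, of x c] insert.hyps(2) by auto
  then have "ip (\<Sum>j\<in>F. smul (c j) (e j)) (smul (c x) (e x)) = 0" by (simp add: ip_smul_right)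
  from pythagoras[OF this] show ?case
    using insert orthonormal_norm[OF insert.prems, of x] orthonormal_subset[OF insert.prems subset_insertI]
    by (simp add: norm_smul add.commute)
qed simp

text \<open>The residual is orthogonal to the projection. Keeping it explicit gives Bessel's
  inequality at once and Parseval's identity in the limit.\<close>

lemma norm_sq_projection:
  assumes "finite A" "orthonormal e A"
  shows "(norm f)\<^sup>2 = (norm (f - (\<Sum>j\<in>A. smul (ip f (e j)) (e j))))\<^sup>2 + (\<Sum>j\<in>A. (norm (ip f (e j)))\<^sup>2)"
proof -
  define p where "p = (\<Sum>j\<in>A. smul (ip f (e j)) (e j))"
  have 0: "ip (e i) (f - p) = 0" if "i \<in> A" for i
    using ip_combination[OF assms order_refl that, of "\<lambda>j. ip f (e j)"] that
      ip_eq_0_commute[of "f - p" "e i"] by (simp add: p_def ip_diff_left)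
  have "ip p (f - p) = 0"
    by (subst p_def) (simp add: ip_sum_left ip_smul_left 0)
  from pythagoras[OF this] show ?thesis
    using norm_combination[OF assms, of "\<lambda>j. ip f (e j)"] by (simp add: p_def)
qed

lemma orthonormal_independent:
  assumes "orthonormal e A"
  shows "independent (e ` A)"
proof -
  have on: "orthonormal (\<lambda>v. v) (e ` A)"
    using assms orthonormal_inj_on[OF assms] by (auto simp: orthonormal_def inj_on_eq_iff)
  have "c v = 0" if "finite S" "S \<subseteq> e ` A" "(\<Sum>v\<in>S. smul (c v) v) = 0" "v \<in> S" for S c v
    using ip_combination[OF that(1) on that(2), of v c] that by auto
  then show ?thesis unfolding dependent_explicit by blast
qed

text \<open>A maximal orthonormal set is complete, since a vector orthogonal to it could be
  normalized and added. Separability makes the set countable and infinite dimension makes it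
  infinite, so it can be enumerated by the natural numbers.\<close>

lemma orthonormal_basis_exists:
  assumes separable: "\<exists>D::'h set. countable D \<and> closure D = UNIV"
    and infinite_dim: "\<not> (\<exists>Basis. finite_dimensional_vector_space smul Basis)"
  obtains e :: "nat \<Rightarrow> 'h" where "orthonormal e UNIV" "\<And>x. (\<And>i. ip x (e i) = 0) \<Longrightarrow> x = 0"
proof -
  have "\<exists>S\<in>{S. orthonormal (\<lambda>v. v) S}. \<forall>X\<in>{S. orthonormal (\<lambda>v. v) S}. S \<subseteq> X \<longrightarrow> X = S"
  proof (rule subset_Zorn')
    fix C assume C: "subset.chain {S. orthonormal (\<lambda>v. v) S} C"
    have "ip v w = of_bool (v = w)" if vw: "v \<in> \<Union> C" "w \<in> \<Union> C" for v w
    proof -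
      obtain X where "X \<in> C" "v \<in> X" "w \<in> X"
        using C vw unfolding subset_chain_def by blast
      moreover from this have "orthonormal (\<lambda>v. v) X" using C by (auto simp: subset_chain_def)
      ultimately show ?thesis by (simp add: orthonormal_def)
    qed
    then show "\<Union> C \<in> {S. orthonormal (\<lambda>v. v) S}" by (simp add: orthonormal_def)
  qed
  then obtain S where S: "orthonormal (\<lambda>v. v) S"
    and max: "\<And>X. orthonormal (\<lambda>v. v) X \<Longrightarrow> S \<subseteq> X \<Longrightarrow> X = S" by auto
  have complete: "x = 0" if 0: "\<And>v. v \<in> S \<Longrightarrow> ip x v = 0" for x
  proof (rule ccontr)
    assume x: "x \<noteq> 0"
    define y where "y = smul (of_real (inverse (norm x))) x"
    have y: "ip y v = 0" "ip v y = 0" if "v \<in> S" for v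
      using 0[OF that] ip_eq_0_commute[of y v] by (simp_all add: y_def ip_smul_left)
    have "norm y = 1"
      using x by (simp add: y_def smul_of_real del: of_real_inverse)
    then have yy: "ip y y = 1" by (simp add: ip_self)
    have "orthonormal (\<lambda>v. v) (insert y S)"
      using S y yy by (auto simp: orthonormal_def)
    then have "y \<in> S" using max by blast
    then show False using y(1) yy by force
  qed
  have "countable S"
  proof -
    obtain D :: "'h set" where D: "countable D" "closure D = UNIV" using separable by blast
    \<comment> \<open>Distinct orthonormal vectors are sqrt 2 apart, so points within 1/2 of them
      cannot coincide.\<close>
    have "\<exists>d\<in>D. dist d v < 1 / 2" for v
      by (metis D(2) UNIV_I closure_approachable half_gt_zero zero_less_one)
    then obtain d where d: "\<And>v. d v \<in> D" "\<And>v. dist (d v) v < 1 / 2" by metis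
    have "inj_on d S"
    proof (rule inj_onI, rule ccontr)
      fix v w assume vw: "v \<in> S" "w \<in> S" "d v = d w" "v \<noteq> w"
      have "dist v w < 1"
        using dist_triangle3[of v w "d v"] d(2)[of v] d(2)[of w] vw(3) by simp
      moreover have "ip v (- w) = 0"
        using S vw ip_eq_0_commute[of "- w" v] by (simp add: orthonormal_def ip_minus_left)
      then have "(norm (v - w))\<^sup>2 = 2"
        using pythagoras[of v "- w"] orthonormal_norm[OF S] vw by simp
      ultimately show False
        using power_strict_mono[of "norm (v - w)" 1 2] by (simp add: dist_norm)
    qed
    moreover have "countable (d ` S)" by (rule countable_subset[OF _ D(1)]) (use d(1) in blast)
    ultimately show ?thesis by (metis countable_image_inj_on)
  qed
  moreover have "infinite S"
  proof
    assume fin: "finite S"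
    \<comment> \<open>With finite \<open>S\<close>, subtracting the projection leaves a vector
      orthogonal to \<open>S\<close>, which completeness forces to be 0.\<close>
    have "f \<in> span S" for f
    proof -
      have "ip (f - (\<Sum>j\<in>S. smul (ip f j) j)) v = 0" if "v \<in> S" for v
        using ip_combination[OF fin S order_refl that, of "\<lambda>j. ip f j"] that
        by (simp add: ip_diff_left)
      then have "f = (\<Sum>j\<in>S. smul (ip f j) j)" using complete by force
      then show ?thesis by (metis (no_types, lifting) span_base span_scale span_sum)
    qed
    then have "span S = UNIV" by blast
    then have "finite_dimensional_vector_space smul S"
      using fin orthonormal_independent[OF S] by unfold_locales auto
    then show False using infinite_dim by blast
  qed
  ultimately obtain h where h: "bij_betw h (UNIV :: nat set) S"
    by (metis countableE_infinite bij_betw_inv)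
  show thesis
  proof (rule that[of h])
    show "orthonormal h UNIV"
      using S h by (auto simp: orthonormal_def bij_betw_def inj_eq)
    show "x = 0" if "\<And>i. ip x (h i) = 0" for x
      using complete[of x] that h by (auto simp: bij_betw_def)
  qed
qed

end

section \<open>Frames and Fourier coefficients\<close>

lemma intensity_diff_sq_le:
  "(intensity ip \<phi> f n - intensity ip \<phi> g n)\<^sup>2 \<le> (norm (ip f (\<phi> n)))\<^sup>2 + (norm (ip g (\<phi> n)))\<^sup>2"
  unfolding intensity_def power2_diff by simp

context
  fixes ip :: "'h::banach \<Rightarrow> 'h \<Rightarrow> 'k::rc_scalar" and I :: "'i set" and \<phi> :: "'i \<Rightarrow> 'h"
  assumes frame: "is_frame ip I \<phi>"
begin

text \<open>An infinite sum defaults to 0 when it is not summable; this guarantees that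
  \<open>intensity_dist\<close> is a genuine distance of sequences.\<close>

lemma frame_intensity_diff_summable:
  "(\<lambda>n. (intensity ip \<phi> f n - intensity ip \<phi> g n)\<^sup>2) summable_on I"
proof (rule summable_on_comparison_test)
  show "(\<lambda>n. (norm (ip f (\<phi> n)))\<^sup>2 + (norm (ip g (\<phi> n)))\<^sup>2) summable_on I"
    using frame by (intro summable_on_add) (auto simp: is_frame_def)
qed (simp_all add: intensity_diff_sq_le)

lemma frame_intensity_diff_le:
  assumes "n \<in> I"
  shows "\<bar>norm (ip f (\<phi> n)) - norm (ip g (\<phi> n))\<bar> \<le> intensity_dist ip I \<phi> f g"
proof -
  have "(\<Sum>n\<in>{n}. (intensity ip \<phi> f n - intensity ip \<phi> g n)\<^sup>2)
      \<le> (\<Sum>\<^sub>\<infinity>n\<in>I. (intensity ip \<phi> f n - intensity ip \<phi> g n)\<^sup>2)"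
    using assms by (intro finite_sum_le_infsum frame_intensity_diff_summable) auto
  then show ?thesis
    by (simp add: intensity_dist_def l2_norm_def intensity_def real_le_rsqrt)
qed

lemma frame_intensity_dist_bounded:
  obtains L where "L > 0" "\<And>f g. intensity_dist ip I \<phi> f g \<le> L * (norm f + norm g)"
proof -
  obtain B where B: "B > 0"
    "\<And>f. (\<lambda>n. (norm (ip f (\<phi> n)))\<^sup>2) summable_on I"
    "\<And>f. (\<Sum>\<^sub>\<infinity>n\<in>I. (norm (ip f (\<phi> n)))\<^sup>2) \<le> B * (norm f)\<^sup>2"
    using frame unfolding is_frame_def by blast
  have "intensity_dist ip I \<phi> f g \<le> sqrt B * (norm f + norm g)" for f g
  proof -
    have "(\<Sum>\<^sub>\<infinity>n\<in>I. (intensity ip \<phi> f n - intensity ip \<phi> g n)\<^sup>2)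
        \<le> (\<Sum>\<^sub>\<infinity>n\<in>I. (norm (ip f (\<phi> n)))\<^sup>2 + (norm (ip g (\<phi> n)))\<^sup>2)"
      by (intro infsum_mono frame_intensity_diff_summable summable_on_add B intensity_diff_sq_le)
    also have "\<dots> \<le> B * (norm f)\<^sup>2 + B * (norm g)\<^sup>2"
      using B(2,3) by (simp add: infsum_add add_mono)
    also have "\<dots> \<le> B * (norm f + norm g)\<^sup>2"
      using B(1) by (simp add: power2_sum algebra_simps)
    finally have "intensity_dist ip I \<phi> f g \<le> sqrt (B * (norm f + norm g)\<^sup>2)"
      unfolding intensity_dist_def l2_norm_def by (rule real_sqrt_le_mono)
    then show ?thesis by (simp add: real_sqrt_mult)
  qed
  then show thesis using that[of "sqrt B"] B(1) by simp
qed

text \<open>Split the intensity distance \<delta> into its powers with exponents 1 - \<mu> and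
  \<mu>; the upper frame bound turns the first into a power of the norms.\<close>

lemma lipschitz_imp_holder_stable:
  assumes lip: "lipschitz_stable_phase_retrieval smul ip I \<phi> S" and "0 < \<mu>" "\<mu> \<le> 1"
  shows "holder_stable_phase_retrieval smul ip I \<phi> \<mu> S"
proof -
  obtain K where K: "\<And>f g. f \<in> S \<Longrightarrow> g \<in> S \<Longrightarrow>
      phase_dist smul f g \<le> K * (norm f + norm g) powr 0 * intensity_dist ip I \<phi> f g powr 1"
    using lip unfolding lipschitz_stable_phase_retrieval_def holder_stable_phase_retrieval_def
    by auto
  obtain L where L: "L > 0" "\<And>f g. intensity_dist ip I \<phi> f g \<le> L * (norm f + norm g)"
    by (rule frame_intensity_dist_bounded) blast
  show ?thesis unfolding holder_stable_phase_retrieval_def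
  proof (intro exI ballI)
    fix f g assume fg: "f \<in> S" "g \<in> S"
    define \<delta> where "\<delta> = intensity_dist ip I \<phi> f g"
    have \<delta>: "\<delta> \<ge> 0" by (simp add: \<delta>_def intensity_dist_def l2_norm_def infsum_nonneg)
    have "phase_dist smul f g \<le> (K * (norm f + norm g) powr 0) * \<delta>"
      using K[OF fg] \<delta> by (simp add: \<delta>_def)
    \<comment> \<open>The power with exponent 0 is 0 or 1, and \<open>K\<close> may be negative; the
      absolute value covers all cases.\<close>
    also have "\<dots> \<le> \<bar>K\<bar> * \<delta>"
      by (intro mult_right_mono \<delta>) auto
    also have "\<delta> = \<delta> powr (1 - \<mu>) * \<delta> powr \<mu>"
      using \<delta> by (simp flip: powr_add)
    also have "\<bar>K\<bar> * \<dots> \<le> \<bar>K\<bar> * ((L * (norm f + norm g)) powr (1 - \<mu>) * \<delta> powr \<mu>)"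
      using assms(2,3) \<delta> L(2)[of f g]
      by (intro mult_left_mono mult_right_mono powr_mono2) (simp_all add: \<delta>_def)
    also have "\<dots> = (\<bar>K\<bar> * L powr (1 - \<mu>)) * (norm f + norm g) powr (1 - \<mu>) * \<delta> powr \<mu>"
      using L(1) by (simp add: powr_mult)
    finally show "phase_dist smul f g \<le> (\<bar>K\<bar> * L powr (1 - \<mu>)) * (norm f + norm g) powr (1 - \<mu>) *
        intensity_dist ip I \<phi> f g powr \<mu>" by (simp add: \<delta>_def)
  qed
qed

end

text \<open>The frame is built over a sum type; this moves it to the natural numbers.\<close>

lemma is_frame_reindex:
  fixes ip :: "'h::banach \<Rightarrow> 'h \<Rightarrow> 'k::rc_scalar"
  assumes h: "bij_betw h J I" and frame: "is_frame ip I \<phi>"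
  shows "is_frame ip J (\<lambda>j. \<phi> (h j))"
proof -
  have "(\<lambda>j. (norm (ip f (\<phi> (h j))))\<^sup>2) summable_on J \<longleftrightarrow> (\<lambda>i. (norm (ip f (\<phi> i)))\<^sup>2) summable_on I"
    and "(\<Sum>\<^sub>\<infinity>j\<in>J. (norm (ip f (\<phi> (h j))))\<^sup>2) = (\<Sum>\<^sub>\<infinity>i\<in>I. (norm (ip f (\<phi> i)))\<^sup>2)" for f
    using summable_on_reindex_bij_betw[OF h, of "\<lambda>i. (norm (ip f (\<phi> i)))\<^sup>2"]
      infsum_reindex_bij_betw[OF h, of "\<lambda>i. (norm (ip f (\<phi> i)))\<^sup>2"] by auto
  moreover have "countable J"
    using frame h countable_image_inj_on[of h J] by (simp add: is_frame_def bij_betw_def)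
  ultimately show ?thesis using frame by (simp add: is_frame_def)
qed

lemma intensity_dist_reindex:
  assumes "bij_betw h J I"
  shows "intensity_dist ip J (\<lambda>j. \<phi> (h j)) f g = intensity_dist ip I \<phi> f g"
  using infsum_reindex_bij_betw[OF assms,
      of "\<lambda>i. (intensity ip \<phi> f i - intensity ip \<phi> g i)\<^sup>2"]
  by (simp add: intensity_dist_def l2_norm_def intensity_def)

lemma phase_dist_le: "norm \<alpha> = 1 \<Longrightarrow> phase_dist smul f g \<le> norm (f - smul \<alpha> g)"
  unfolding phase_dist_def by (rule cINF_lower) (auto intro!: bdd_belowI[of _ 0])

lemma phase_dist_ge:
  assumes "\<And>\<alpha>. norm \<alpha> = 1 \<Longrightarrow> c \<le> norm (f - smul \<alpha> g)"
  shows "c \<le> phase_dist smul f g"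
  unfolding phase_dist_def by (intro cINF_greatest) (auto intro: assms exI[of _ 1])

context hilbert_space
begin

text \<open>The Parseval part alone supplies the lower bound 1, so the added vectors may be
  arbitrarily small. By Cauchy-Schwarz they raise the upper bound by at most the sum of their
  squared norms.\<close>

lemma parseval_union_frame:
  fixes \<psi> :: "'i \<Rightarrow> 'h"
  assumes parseval: "\<And>f. ((\<lambda>j. (norm (ip f (e j)))\<^sup>2) has_sum (norm f)\<^sup>2) (UNIV :: 'j set)"
    and summable: "(\<lambda>i. (norm (\<psi> i))\<^sup>2) summable_on UNIV"
    and countable: "countable (UNIV :: 'j set)" "countable (UNIV :: 'i set)"
  shows "is_frame ip UNIV (case_sum e \<psi>)"
proof -
  define B where "B = (\<Sum>\<^sub>\<infinity>i. (norm (\<psi> i))\<^sup>2)"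
  have B: "B \<ge> 0" by (simp add: B_def infsum_nonneg)
  have *: "(\<lambda>n. (norm (ip f (case_sum e \<psi> n)))\<^sup>2) summable_on UNIV \<and>
      1 * (norm f)\<^sup>2 \<le> (\<Sum>\<^sub>\<infinity>n. (norm (ip f (case_sum e \<psi> n)))\<^sup>2) \<and>
      (\<Sum>\<^sub>\<infinity>n. (norm (ip f (case_sum e \<psi> n)))\<^sup>2) \<le> (1 + B) * (norm f)\<^sup>2" for f
  proof -
    define F where "F = (\<lambda>n. (norm (ip f (case_sum e \<psi> n)))\<^sup>2)"
    have le: "(norm (ip f (\<psi> i)))\<^sup>2 \<le> (norm f)\<^sup>2 * (norm (\<psi> i))\<^sup>2" for i
      unfolding power_mult_distrib[symmetric] by (intro power_mono cauchy_schwarz) simp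
    have s: "(\<lambda>i. (norm f)\<^sup>2 * (norm (\<psi> i))\<^sup>2) summable_on UNIV"
      by (rule summable_on_cmult_right[OF summable])
    then have s': "(\<lambda>i. (norm (ip f (\<psi> i)))\<^sup>2) summable_on UNIV"
      by (rule summable_on_comparison_test) (auto simp: le)
    define T where "T = (\<Sum>\<^sub>\<infinity>i. (norm (ip f (\<psi> i)))\<^sup>2)"
    have T0: "T \<ge> 0" by (simp add: T_def infsum_nonneg)
    have "T \<le> (\<Sum>\<^sub>\<infinity>i. (norm f)\<^sup>2 * (norm (\<psi> i))\<^sup>2)"
      unfolding T_def by (intro infsum_mono s s') (simp add: le)
    then have T: "T \<le> (norm f)\<^sup>2 * B" by (simp add: B_def infsum_cmult_right')
    have "(F has_sum (norm f)\<^sup>2) (range Inl)"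
      using parseval[of f] by (subst has_sum_reindex) (simp_all add: F_def o_def)
    moreover have "(F has_sum T) (range Inr)"
      using s' by (subst has_sum_reindex) (simp_all add: F_def o_def T_def)
    ultimately have "(F has_sum ((norm f)\<^sup>2 + T)) (range Inl \<union> range Inr)"
      by (rule has_sum_Un_disjoint) auto
    then have "(F has_sum ((norm f)\<^sup>2 + T)) UNIV" by (simp add: UNIV_sum)
    then show ?thesis
      using T0 T unfolding F_def by (auto simp: algebra_simps infsumI summable_on_def)
  qed
  have "countable (UNIV :: ('j + 'i) set)"
    using countable by (simp add: UNIV_sum)
  then show ?thesis
    unfolding is_frame_def using * B
    by (intro conjI exI[of _ 1] exI[of _ "1 + B"] allI) auto
qed

text \<open>Uniqueness behind the description operator in \<open>orth_proj\<close>: the difference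
  of two candidates lies in \<open>V\<close> and is orthogonal to itself.\<close>

lemma orth_proj_eqI:
  assumes V: "subspace V" and p: "p \<in> V" "\<And>v. v \<in> V \<Longrightarrow> ip (f - p) v = 0"
  shows "orth_proj ip V f = p"
  unfolding orth_proj_def
proof (rule the_equality)
  fix q assume q: "q \<in> V \<and> (\<forall>v\<in>V. ip (f - q) v = 0)"
  have d: "p - q \<in> V" using subspace_diff[OF V] p(1) q by blast
  have "ip (p - q) (p - q) = ip (f - q) (p - q) - ip (f - p) (p - q)"
    by (simp flip: ip_diff_left)
  then have "ip (p - q) (p - q) = 0" using p(2)[OF d] q d by simp
  then show "q = p" by (simp add: ip_self)
qed (use p in auto)

end

section \<open>Fourier series and the spans of initial basis vectors\<close>

locale complete_orthonormal_sequence = hilbert_space smul ip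
  for smul :: "'k::rc_scalar \<Rightarrow> 'h::banach \<Rightarrow> 'h" and ip :: "'h \<Rightarrow> 'h \<Rightarrow> 'k" +
  fixes e :: "nat \<Rightarrow> 'h"
  assumes orthonormal_e: "orthonormal e UNIV"
    and complete_e: "(\<And>i. ip x (e i) = 0) \<Longrightarrow> x = 0"
begin

lemma ip_e: "ip (e i) (e j) = of_bool (i = j)"
  using orthonormal_e by (simp add: orthonormal_def)

lemma norm_e [simp]: "norm (e i) = 1"
  using orthonormal_norm[OF orthonormal_e] by simp

lemma norm_coefficient_le: "norm (ip x (e i)) \<le> norm x"
  using cauchy_schwarz[of x "e i"] by simp

lemma ip_partial_sum: "ip (\<Sum>j<n. smul (c j) (e j)) (e i) = (if i < n then c i else 0)"
  using ip_combination[OF finite_lessThan orthonormal_e, of n i c] by simp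

lemma norm_sq_partial_sum:
  "(norm f)\<^sup>2 = (norm (f - (\<Sum>j<n. smul (ip f (e j)) (e j))))\<^sup>2 + (\<Sum>j<n. (norm (ip f (e j)))\<^sup>2)"
  by (rule norm_sq_projection) (auto intro: orthonormal_subset[OF orthonormal_e])

text \<open>Bessel's inequality makes the partial sums Cauchy, so they converge to some
  \<open>g\<close>; \<open>f\<close> and \<open>g\<close> have the same coefficients, hence agree by
  \<open>complete_e\<close>.\<close>

lemma fourier_series_sums: "(\<lambda>j. smul (ip f (e j)) (e j)) sums f"
proof -
  let ?c = "\<lambda>j. smul (ip f (e j)) (e j)"
  have "summable (\<lambda>j. (norm (ip f (e j)))\<^sup>2)"
  proof (rule summableI_nonneg_bounded)
    show "(\<Sum>j<n. (norm (ip f (e j)))\<^sup>2) \<le> (norm f)\<^sup>2" for n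
      using norm_sq_partial_sum[of f n] by simp
  qed simp
  then have cauchy: "\<And>r. r > 0 \<Longrightarrow> \<exists>N. \<forall>m\<ge>N. \<forall>n. norm (\<Sum>j\<in>{m..<n}. (norm (ip f (e j)))\<^sup>2) < r"
    unfolding summable_Cauchy by blast
  have "summable ?c"
    unfolding summable_Cauchy
  proof (intro allI impI)
    fix r :: real assume r: "r > 0"
    then obtain N where N: "\<And>m n. m \<ge> N \<Longrightarrow> norm (\<Sum>j\<in>{m..<n}. (norm (ip f (e j)))\<^sup>2) < r\<^sup>2"
      using cauchy[of "r\<^sup>2"] by auto
    have "norm (sum ?c {m..<n}) < r" if "m \<ge> N" for m n
    proof -
      have "(norm (sum ?c {m..<n}))\<^sup>2 < r\<^sup>2"
        using N[OF that, of n] orthonormal_subset[OF orthonormal_e subset_UNIV]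
        by (simp add: norm_combination)
      then show ?thesis using r power2_less_imp_less by force
    qed
    then show "\<exists>N. \<forall>m\<ge>N. \<forall>n. norm (sum ?c {m..<n}) < r" by blast
  qed
  then have sums: "?c sums suminf ?c" by (rule summable_sums)
  define g where "g = suminf ?c"
  have lim: "(\<lambda>n. norm (g - (\<Sum>j<n. ?c j))) \<longlonglongrightarrow> 0"
    using tendsto_norm[OF tendsto_diff[OF tendsto_const[of g] sums[unfolded sums_def]]]
    by (simp add: g_def)
  have "ip (f - g) (e i) = 0" for i
  proof -
    \<comment> \<open>Once n > i, the partial sum has the same i-th coefficient as \<open>f\<close>,
      so it may replace \<open>f\<close> before Cauchy-Schwarz is applied.\<close>
    have "norm (ip (f - g) (e i)) \<le> norm (g - (\<Sum>j<n. ?c j))" if "n \<ge> Suc i" for n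
    proof -
      have "ip (f - g) (e i) = - ip (g - (\<Sum>j<n. ?c j)) (e i)"
        using that by (simp add: ip_diff_left ip_partial_sum)
      then show ?thesis
        using norm_coefficient_le[of "g - (\<Sum>j<n. ?c j)" i] by simp
    qed
    then have "norm (ip (f - g) (e i)) \<le> 0"
      by (intro tendsto_lowerbound[OF lim] eventually_sequentiallyI[of "Suc i"]) auto
    then show ?thesis by simp
  qed
  then have "f = g" using complete_e[of "f - g"] by simp
  then show ?thesis using sums by (simp add: g_def)
qed

lemma parseval: "((\<lambda>j. (norm (ip f (e j)))\<^sup>2) has_sum (norm f)\<^sup>2) UNIV"
proof (rule sums_nonneg_imp_has_sum)
  have "(\<lambda>n. (norm f)\<^sup>2 - (norm (f - (\<Sum>j<n. smul (ip f (e j)) (e j))))\<^sup>2) \<longlonglongrightarrow> (norm f)\<^sup>2 - (norm (f - f))\<^sup>2"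
    by (intro tendsto_intros fourier_series_sums[unfolded sums_def])
  moreover have "(norm f)\<^sup>2 - (norm (f - (\<Sum>j<n. smul (ip f (e j)) (e j))))\<^sup>2 = (\<Sum>j<n. (norm (ip f (e j)))\<^sup>2)" for n
    using norm_sq_partial_sum[of f n] by simp
  ultimately show "(\<lambda>j. (norm (ip f (e j)))\<^sup>2) sums (norm f)\<^sup>2" by (simp add: sums_def)
qed simp

text \<open>The basis is indexed from 0, so \<open>e n\<close> first enters at
  \<open>m = n + 1\<close>.\<close>

definition initial_span :: "nat \<Rightarrow> 'h set"
  where "initial_span m = span (e ` {..<m})"

lemma subspace_initial_span: "subspace (initial_span m)"
  by (simp add: initial_span_def)

lemma dim_initial_span: "dim (initial_span m) = m"
  unfolding initial_span_def
  using dim_span_eq_card_independent[OF orthonormal_independent, of e "{..<m}"]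
    orthonormal_subset[OF orthonormal_e, of "{..<m}"]
    card_image[OF orthonormal_inj_on, of e "{..<m}"] by simp

lemma initial_span_mono: "m \<le> n \<Longrightarrow> initial_span m \<subseteq> initial_span n"
  unfolding initial_span_def by (intro span_mono) auto

lemma e_in_initial_span: "j < m \<Longrightarrow> e j \<in> initial_span m"
  unfolding initial_span_def by (auto intro: span_base)

lemma partial_sum_in_initial_span: "(\<Sum>j<m. smul (c j) (e j)) \<in> initial_span m"
  by (intro subspace_sum subspace_scale subspace_initial_span e_in_initial_span) simp

lemma orthogonal_initial_span:
  assumes "\<And>j. j < m \<Longrightarrow> ip x (e j) = 0" "v \<in> initial_span m"
  shows "ip x v = 0"
  using assms(2) unfolding initial_span_def
proof (rule span_induct)
  show "subspace {v. ip x v = 0}"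
    by (auto simp: subspace_def ip_add_right ip_smul_right)
qed (use assms(1) in auto)

lemma initial_span_coefficient:
  assumes "f \<in> initial_span m" "m \<le> j"
  shows "ip f (e j) = 0"
  using orthogonal_initial_span[of m "e j" f] assms ip_eq_0_commute[of f "e j"]
  by (simp add: ip_e)

lemma initial_span_expansion:
  assumes "f \<in> initial_span m"
  shows "f = (\<Sum>j<m. smul (ip f (e j)) (e j))"
proof -
  have "ip (f - (\<Sum>j<m. smul (ip f (e j)) (e j))) (e i) = 0" for i
    using initial_span_coefficient[OF assms, of i] by (simp add: ip_diff_left ip_partial_sum)
  then show ?thesis using complete_e by (metis eq_iff_diff_eq_0)
qed

end

section \<open>The perturbed orthonormal basis\<close>

text \<open>Polarization works with squared moduli, whereas the frame compares moduli; passing to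
  squares costs a factor proportional to the size of the data.\<close>

lemma abs_diff_squares_le:
  fixes a b :: real
  assumes "0 \<le> a" "a \<le> M" "0 \<le> b" "b \<le> M" "\<bar>a - b\<bar> \<le> \<eta>"
  shows "\<bar>a\<^sup>2 - b\<^sup>2\<bar> \<le> 2 * M * \<eta>"
proof -
  have "\<bar>a\<^sup>2 - b\<^sup>2\<bar> = \<bar>a - b\<bar> * (a + b)"
    using assms by (simp add: power2_eq_square square_diff_square_factored abs_mult)
  also have "\<dots> \<le> \<eta> * (2 * M)"
    using assms by (intro mult_mono) auto
  finally show ?thesis by (simp add: mult_ac)
qed

text \<open>The phase is chosen so that it aligns the largest coordinate; polarization against that
  coordinate controls all the others.\<close>

lemma phase_alignment:
  fixes x y :: "'i \<Rightarrow> 'k::rc_scalar"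
  assumes u: "norm u = 1" "\<And>z. 2 * norm z \<le> norm (z + scalar_cnj z) + norm (u * z + scalar_cnj (u * z))"
    and p: "p \<in> A" "\<And>k. k \<in> A \<Longrightarrow> norm (x k) \<le> norm (x p)" "\<And>k. k \<in> A \<Longrightarrow> norm (y k) \<le> norm (x p)"
    and \<eta>: "\<And>k. k \<in> A \<Longrightarrow> \<bar>norm (x k) - norm (y k)\<bar> \<le> \<eta>"
      "\<And>k v. k \<in> A \<Longrightarrow> v \<in> {1, u} \<Longrightarrow> \<bar>norm (x p + v * x k) - norm (y p + v * y k)\<bar> \<le> \<eta>"
  shows "\<exists>\<alpha>. norm \<alpha> = 1 \<and> (\<forall>k\<in>A. norm (x k - \<alpha> * y k) \<le> 9 * \<eta>)"
proof (cases "x p = 0")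
  case True
  then have "x k = 0 \<and> y k = 0" if "k \<in> A" for k using p(2,3)[OF that] by simp
  moreover have "\<eta> \<ge> 0" using \<eta>(1)[OF p(1)] by linarith
  ultimately show ?thesis by (intro exI[of _ 1]) simp
next
  case False
  define N where "N = norm (x p)"
  have N: "N > 0" using False by (simp add: N_def)
  \<comment> \<open>The products with the reference coordinate do not change under a common phase,
    so they can be compared before a phase is chosen.\<close>
  define z where "z k = x k * scalar_cnj (x p) - y k * scalar_cnj (y p)" for k
  have z: "norm (z k) \<le> 8 * N * \<eta>" if k: "k \<in> A" for k
  proof -
    have "norm (v * z k + scalar_cnj (v * z k)) \<le> 8 * N * \<eta>" if v: "v \<in> {1, u}" for v
    proof -
      have nv: "norm v = 1" using v u(1) by auto
      \<comment> \<open>The three differences of squares are at most 4 N \<eta>, 2 N \<eta> and 2 N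
        \<eta>, the first because the sums have modulus up to 2 N. Hence the 8.\<close>
      define D where "D = ((norm (x p + v * x k))\<^sup>2 - (norm (y p + v * y k))\<^sup>2)
        - ((norm (x k))\<^sup>2 - (norm (y k))\<^sup>2) - ((norm (x p))\<^sup>2 - (norm (y p))\<^sup>2)"
      have "v * z k + scalar_cnj (v * z k) =
          (v * x k * scalar_cnj (x p) + scalar_cnj (v * x k * scalar_cnj (x p)))
          - (v * y k * scalar_cnj (y p) + scalar_cnj (v * y k * scalar_cnj (y p)))"
        by (simp add: z_def right_diff_distrib scalar_cnj_diff mult.assoc)
      also have "\<dots> = of_real D"
        using norm_sq_add_scalar[of "v * x k" "x p"] norm_sq_add_scalar[of "v * y k" "y p"]
        by (simp add: D_def norm_mult nv add.commute)
      finally have "norm (v * z k + scalar_cnj (v * z k)) = \<bar>D\<bar>" by (simp only: norm_of_real)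
      moreover have "\<bar>(norm (x p + v * x k))\<^sup>2 - (norm (y p + v * y k))\<^sup>2\<bar> \<le> 2 * (2 * N) * \<eta>"
      proof (rule abs_diff_squares_le)
        show "norm (x p + v * x k) \<le> 2 * N" "norm (y p + v * y k) \<le> 2 * N"
          using norm_triangle_ineq[of "x p" "v * x k"] norm_triangle_ineq[of "y p" "v * y k"]
            p(2,3)[OF k] p(3)[OF p(1)] by (auto simp: norm_mult nv N_def)
      qed (use \<eta>(2)[OF k v] in auto)
      moreover have "\<bar>(norm (x i))\<^sup>2 - (norm (y i))\<^sup>2\<bar> \<le> 2 * N * \<eta>" if "i \<in> A" for i
        using that p \<eta>(1) by (intro abs_diff_squares_le) (auto simp: N_def)
      note this[OF k] this[OF p(1)]
      ultimately show ?thesis unfolding D_def by linarith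
    qed
    from this[of 1] this[of u] u(2)[of "z k"] show ?thesis by simp
  qed
  \<comment> \<open>The phase of \<open>y p\<close>, with an arbitrary unit if
    \<open>y p = 0\<close>. Dividing the phase of \<open>x p\<close> by it gives the aligning
    \<alpha>.\<close>
  define s where "s = (if y p = 0 then 1 else y p / of_real (norm (y p)))"
  have s: "norm s = 1" "y p = of_real (norm (y p)) * s"
    by (auto simp: s_def norm_divide)
  define t where "t = x p / of_real N"
  have t: "norm t = 1" "x p = of_real N * t"
    using N by (auto simp: t_def norm_divide N_def)
  define \<alpha> where "\<alpha> = t / s"
  have \<alpha>: "norm \<alpha> = 1" by (simp add: \<alpha>_def norm_divide s t)
  have \<alpha>y: "\<alpha> * y p = of_real (norm (y p)) * t"
  proof -
    have "s \<noteq> 0" using s(1) by auto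
    then show ?thesis by (subst s(2)) (simp add: \<alpha>_def)
  qed
  \<comment> \<open>After alignment the two reference coordinates differ only in modulus, hence by
    at most \<eta>.\<close>
  have "norm (scalar_cnj (y p) - \<alpha> * scalar_cnj (x p)) = norm (\<alpha> * y p - x p)"
  proof -
    have "\<alpha> * scalar_cnj \<alpha> = 1" by (simp add: mult_scalar_cnj \<alpha>)
    then have "\<alpha> * scalar_cnj (\<alpha> * y p - x p) = scalar_cnj (y p) - \<alpha> * scalar_cnj (x p)"
      by (simp add: scalar_cnj_diff scalar_cnj_mult right_diff_distrib flip: mult.assoc)
    then show ?thesis by (metis \<alpha> mult_1 norm_mult norm_scalar_cnj)
  qed
  also have "\<alpha> * y p - x p = of_real (norm (y p) - N) * t"
    unfolding \<alpha>y by (subst t(2)) (simp add: left_diff_distrib)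
  also have "norm \<dots> \<le> \<eta>"
    using \<eta>(1)[OF p(1)] by (simp add: norm_mult t(1) N_def abs_minus_commute del: of_real_diff)
  finally have d: "norm (scalar_cnj (y p) - \<alpha> * scalar_cnj (x p)) \<le> \<eta>" .
  have "norm (x k - \<alpha> * y k) \<le> 9 * \<eta>" if k: "k \<in> A" for k
  proof -
    \<comment> \<open>Both terms are bounded by multiples of N, 8 N \<eta> and N \<eta>, because no
      coordinate exceeds N; so dividing by the modulus N of \<open>x p\<close> is harmless however
      small it is.\<close>
    have "(x k - \<alpha> * y k) * scalar_cnj (x p) = z k + y k * (scalar_cnj (y p) - \<alpha> * scalar_cnj (x p))"
      by (simp add: z_def algebra_simps)
    then have "norm (x k - \<alpha> * y k) * N \<le>
        norm (z k) + norm (y k) * norm (scalar_cnj (y p) - \<alpha> * scalar_cnj (x p))"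
      by (metis N_def norm_mult norm_scalar_cnj norm_triangle_ineq)
    also have "\<dots> \<le> 8 * N * \<eta> + N * \<eta>"
      using z[OF k] p(3)[OF k] d N by (intro add_mono mult_mono) (auto simp: N_def)
    also have "\<dots> = 9 * \<eta> * N" by simp
    finally show ?thesis using N by simp
  qed
  then show ?thesis using \<alpha> by blast
qed

text \<open>The reference coordinate is where the largest modulus among all coordinates of both
  vectors occurs. If it belongs to \<open>y\<close>, the roles are exchanged and the phase is
  inverted.\<close>

lemma coordinate_phase_retrieval:
  fixes x y :: "'i \<Rightarrow> 'k::rc_scalar"
  assumes u: "norm u = 1" "\<And>z. 2 * norm z \<le> norm (z + scalar_cnj z) + norm (u * z + scalar_cnj (u * z))"
    and A: "finite A"
    and \<eta>: "\<And>k. k \<in> A \<Longrightarrow> \<bar>norm (x k) - norm (y k)\<bar> \<le> \<eta>"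
      "\<And>j k v. j \<in> A \<Longrightarrow> k \<in> A \<Longrightarrow> v \<in> {1, u} \<Longrightarrow>
        \<bar>norm (x j + v * x k) - norm (y j + v * y k)\<bar> \<le> \<eta>"
  shows "\<exists>\<alpha>. norm \<alpha> = 1 \<and> (\<forall>k\<in>A. norm (x k - \<alpha> * y k) \<le> 9 * \<eta>)"
proof (cases "A = {}")
  case True
  then show ?thesis using norm_one by blast
next
  case False
  define M where "M k = max (norm (x k)) (norm (y k))" for k
  have "Max (M ` A) \<in> M ` A" using A False by (intro Max_in) auto
  then obtain p where "p \<in> A" "M p = Max (M ` A)" by (metis imageE)
  then have p: "p \<in> A" "\<And>k. k \<in> A \<Longrightarrow> M k \<le> M p" using A by simp_all
  show ?thesis
  proof (cases "norm (y p) \<le> norm (x p)")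
    case True
    then have "norm (x k) \<le> norm (x p)" "norm (y k) \<le> norm (x p)" if "k \<in> A" for k
      using p(2)[OF that] by (auto simp: M_def)
    from phase_alignment[where x = x and y = y and p = p, OF u p(1) this \<eta>(1) \<eta>(2)[OF p(1)]] show ?thesis .
  next
    case False
    then have *: "norm (y k) \<le> norm (y p)" "norm (x k) \<le> norm (y p)" if "k \<in> A" for k
      using p(2)[OF that] by (auto simp: M_def)
    have \<eta>1: "\<bar>norm (y k) - norm (x k)\<bar> \<le> \<eta>" if "k \<in> A" for k
      using \<eta>(1)[OF that] by (simp add: abs_minus_commute)
    have \<eta>2: "\<bar>norm (y p + v * y k) - norm (x p + v * x k)\<bar> \<le> \<eta>" if "k \<in> A" "v \<in> {1, u}" for k v
      using \<eta>(2)[OF p(1) that] by (simp only: abs_minus_commute)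
    from phase_alignment[where x = y and y = x and p = p, OF u p(1) * \<eta>1 \<eta>2]
    obtain \<alpha> where \<alpha>: "norm \<alpha> = 1" "\<And>k. k \<in> A \<Longrightarrow> norm (y k - \<alpha> * x k) \<le> 9 * \<eta>" by blast
    have "norm (x k - inverse \<alpha> * y k) = norm (y k - \<alpha> * x k)" for k
    proof -
      have "\<alpha> \<noteq> 0" using \<alpha>(1) by auto
      then have "y k - \<alpha> * x k = - \<alpha> * (x k - inverse \<alpha> * y k)" by (simp add: right_diff_distrib)
      then show ?thesis by (simp add: norm_mult \<alpha>(1) del: mult_minus_left)
    qed
    then show ?thesis using \<alpha> by (intro exI[of _ "inverse \<alpha>"]) (simp add: norm_inverse)
  qed
qed

text \<open>A majorant, up to a constant, for the squared norms of the coupling vectors: the square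
  of 2^(-max j k) is at most 2^(-j) 2^(-k), which factors into geometric series.\<close>

lemma summable_on_pair_weights:
  "(\<lambda>(j, k, b). (1 / 2) ^ j * (1 / 2) ^ k :: real) summable_on (UNIV :: (nat \<times> nat \<times> bool) set)"
proof -
  have geom: "(\<lambda>k. (1 / 2) ^ k :: real) summable_on (UNIV :: nat set)"
    by (intro summable_nonneg_imp_summable_on summable_geometric) auto
  define h :: "nat \<times> bool \<Rightarrow> real" where "h = (\<lambda>(k, b). (1 / 2) ^ k)"
  have "h summable_on (UNIV \<times> UNIV)"
  proof (rule summable_on_SigmaI)
    show "((\<lambda>b. h (k, b)) has_sum (1 / 2) ^ k * 2) UNIV" for k
      by (rule has_sum_finiteI) (simp_all add: h_def UNIV_bool)
  qed (auto intro: summable_on_cmult_left geom simp: h_def)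
  then have h: "(h has_sum infsum h UNIV) UNIV" by simp
  have "(\<lambda>(j, k, b). (1 / 2) ^ j * (1 / 2) ^ k :: real) summable_on
      ((UNIV :: nat set) \<times> (UNIV :: (nat \<times> bool) set))"
  proof (rule summable_on_SigmaI)
    show "((\<lambda>kb. (case (j, kb) of (j, k, b) \<Rightarrow> (1 / 2) ^ j * (1 / 2) ^ k)) has_sum
        ((1 / 2) ^ j * infsum h UNIV :: real)) (UNIV :: (nat \<times> bool) set)" for j :: nat
      using has_sum_cmult_right[OF h, of "(1 / 2) ^ j"] by (simp add: h_def case_prod_unfold)
  qed (auto intro: summable_on_cmult_left geom)
  then show ?thesis by simp
qed

section \<open>The coupled frame, its stability on initial spans and its failure on the
  approximation classes\<close>

context complete_orthonormal_sequence
begin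

text \<open>The conjugate compensates for the conjugate-linear second argument of \<open>ip\<close>,
  so that \<open>u\<close> itself multiplies the k-th coefficient.\<close>

definition pair_vector :: "'k \<Rightarrow> nat \<times> nat \<times> bool \<Rightarrow> 'h"
  where "pair_vector u = (\<lambda>(j, k, b). smul (of_real ((1 / 2) ^ max j k))
    (e j + smul (if b then scalar_cnj u else 1) (e k)))"

definition pair_frame :: "'k \<Rightarrow> nat + nat \<times> nat \<times> bool \<Rightarrow> 'h"
  where "pair_frame u = case_sum e (pair_vector u)"

lemma ip_pair_vector:
  "ip f (pair_vector u (j, k, b)) =
    of_real ((1 / 2) ^ max j k) * (ip f (e j) + (if b then u else 1) * ip f (e k))"
  by (simp add: pair_vector_def ip_smul_right ip_add_right scalar_cnj_of_real del: of_real_power)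

lemma norm_ip_pair_vector:
  "norm (ip f (pair_vector u (j, k, b))) =
    (1 / 2) ^ max j k * norm (ip f (e j) + (if b then u else 1) * ip f (e k))"
  unfolding ip_pair_vector norm_mult norm_of_real by simp

lemma norm_pair_vector_le:
  assumes "norm u = 1"
  shows "norm (pair_vector u (j, k, b)) \<le> 2 * (1 / 2) ^ max j k"
proof -
  have "norm (e j + smul (if b then scalar_cnj u else 1) (e k)) \<le> 2"
    using norm_triangle_ineq[of "e j" "smul (if b then scalar_cnj u else 1) (e k)"] assms
    by (auto simp: norm_smul split: if_splits)
  then show ?thesis
    unfolding pair_vector_def case_prod_conv norm_smul norm_of_real by simp
qed

lemma is_frame_pair_frame:
  assumes "norm u = 1"
  shows "is_frame ip UNIV (pair_frame u)"
  unfolding pair_frame_def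
proof (rule parseval_union_frame[OF parseval])
  have "(norm (pair_vector u (j, k, b)))\<^sup>2 \<le> 4 * ((1 / 2) ^ j * (1 / 2) ^ k)" for j k b
  proof -
    have "(norm (pair_vector u (j, k, b)))\<^sup>2 \<le> (2 * (1 / 2) ^ max j k)\<^sup>2"
      by (intro power_mono norm_pair_vector_le assms) simp
    also have "\<dots> = 4 * ((1 / 2) ^ max j k * (1 / 2) ^ max j k)"
      by (simp add: power2_eq_square)
    also have "\<dots> \<le> 4 * ((1 / 2) ^ j * (1 / 2) ^ k)"
      by (intro mult_left_mono mult_mono power_decreasing) auto
    finally show ?thesis .
  qed
  then show "(\<lambda>i. (norm (pair_vector u i))\<^sup>2) summable_on UNIV"
    by (intro summable_on_comparison_test[OF summable_on_cmult_right[OF summable_on_pair_weights, of 4]]) auto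
qed auto

text \<open>The 9 is the constant of \<open>coordinate_phase_retrieval\<close>, m counts the
  coordinates in a triangle inequality, and 2^m undoes the weights.\<close>

definition stability_bound :: "nat \<Rightarrow> real"
  where "stability_bound m = 9 * real m * 2 ^ m"

lemma stability_bound_strict_mono: "strict_mono stability_bound"
  unfolding stability_bound_def
  by (rule strict_monoI, rule mult_less_le_imp_less) auto

lemma stability_bound_ge_1: "m \<ge> 1 \<Longrightarrow> stability_bound m \<ge> 1"
  using mult_mono[of 1 "9 * real m" 1 "2 ^ m"] by (simp add: stability_bound_def)

lemma pair_frame_lipschitz_stable:
  assumes u: "norm u = 1" "\<And>z. 2 * norm z \<le> norm (z + scalar_cnj z) + norm (u * z + scalar_cnj (u * z))"
    and fg: "f \<in> initial_span m" "g \<in> initial_span m"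
  shows "phase_dist smul f g \<le> stability_bound m * intensity_dist ip UNIV (pair_frame u) f g"
proof -
  define \<delta> where "\<delta> = intensity_dist ip UNIV (pair_frame u) f g"
  note le = frame_intensity_diff_le[OF is_frame_pair_frame[OF u(1)] UNIV_I, where f = f and g = g, folded \<delta>_def]
  have \<delta>: "\<delta> \<ge> 0" using le[of undefined] by linarith
  \<comment> \<open>The basis vectors carry weight 1; their estimate is weakened to the tolerance
    shared with the pairs.\<close>
  have "\<delta> \<le> 2 ^ m * \<delta>" using \<delta> by (simp add: mult_le_cancel_right1)
  then have 1: "\<bar>norm (ip f (e k)) - norm (ip g (e k))\<bar> \<le> 2 ^ m * \<delta>" for k
    using le[of "Inl k"] by (simp add: pair_frame_def)
  have 2: "\<bar>norm (ip f (e j) + v * ip f (e k)) - norm (ip g (e j) + v * ip g (e k))\<bar> \<le> 2 ^ m * \<delta>"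
    if jk: "j < m" "k < m" and v: "v \<in> {1, u}" for j k v
  proof -
    let ?d = "\<bar>norm (ip f (e j) + v * ip f (e k)) - norm (ip g (e j) + v * ip g (e k))\<bar>"
    obtain b where b: "v = (if b then u else 1)" using v by (metis empty_iff insert_iff)
    have "(1 / 2) ^ m * ?d \<le> (1 / 2) ^ max j k * ?d"
      using jk by (intro mult_right_mono power_decreasing) auto
    also have "\<dots> = \<bar>(1 / 2) ^ max j k * norm (ip f (e j) + v * ip f (e k))
        - (1 / 2) ^ max j k * norm (ip g (e j) + v * ip g (e k))\<bar>"
      by (simp add: abs_mult flip: right_diff_distrib)
    also have "\<dots> \<le> \<delta>"
      using le[of "Inr (j, k, b)"] unfolding pair_frame_def sum.case norm_ip_pair_vector b .
    finally show ?thesis by (simp add: power_one_over field_simps)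
  qed
  obtain \<alpha> where \<alpha>: "norm \<alpha> = 1"
    "\<And>k. k < m \<Longrightarrow> norm (ip f (e k) - \<alpha> * ip g (e k)) \<le> 9 * (2 ^ m * \<delta>)"
    using coordinate_phase_retrieval[OF u finite_lessThan[of m], of "\<lambda>k. ip f (e k)" "\<lambda>k. ip g (e k)"]
      1 2 by (metis lessThan_iff)
  have "f - smul \<alpha> g \<in> initial_span m"
    by (intro subspace_diff subspace_scale subspace_initial_span fg)
  then have "norm (f - smul \<alpha> g) = norm (\<Sum>k<m. smul (ip (f - smul \<alpha> g) (e k)) (e k))"
    using initial_span_expansion by metis
  also have "\<dots> \<le> (\<Sum>k<m. norm (ip f (e k) - \<alpha> * ip g (e k)))"
    by (rule norm_sum[THEN order_trans]) (simp add: norm_smul ip_diff_left ip_smul_left)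
  also have "\<dots> \<le> (\<Sum>k<m. 9 * (2 ^ m * \<delta>))"
    by (intro sum_mono \<alpha>) simp
  also have "\<dots> = stability_bound m * \<delta>"
    by (simp add: stability_bound_def)
  finally show ?thesis using phase_dist_le[OF \<alpha>(1), of smul f g] by (simp add: \<delta>_def)
qed

text \<open>For m <= n the projection is \<open>e 0\<close> and the error is the modulus of
  \<open>c\<close>; as G increases, m = n is the strictest case. For m > n the vector lies in the
  subspace. Its norm is at least 1, which absorbs the factor \<open>norm f\<close>.\<close>

lemma perturbation_in_approx_class:
  assumes "n \<ge> 1" "\<gamma> > 0" "R > 0" and c: "norm c \<le> stability_bound (n + 1) powr (- \<gamma>) * R"
  shows "e 0 + smul c (e n) \<in> approx_class ip initial_span stability_bound \<gamma> R"
  unfolding approx_class_def mem_Collect_eq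
proof (intro allI impI)
  fix m :: nat assume m: "m \<ge> 1"
  define f where "f = e 0 + smul c (e n)"
  have coeff: "ip f (e j) = of_bool (j = 0) + c * of_bool (j = n)" for j
    by (auto simp: f_def ip_add_left ip_smul_left ip_e)
  have f1: "1 \<le> norm f" using norm_coefficient_le[of f 0] assms(1) by (simp add: coeff)
  have "norm (f - orth_proj ip (initial_span m) f) \<le> stability_bound (m + 1) powr (- \<gamma>) * R * norm f"
  proof (cases "m \<le> n")
    case True
    have "orth_proj ip (initial_span m) f = e 0"
    proof (rule orth_proj_eqI[OF subspace_initial_span e_in_initial_span])
      show "ip (f - e 0) v = 0" if "v \<in> initial_span m" for v
        by (rule orthogonal_initial_span[OF _ that]) (use True in \<open>auto simp: ip_diff_left coeff ip_e\<close>)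
    qed (use m in simp)
    then have "norm (f - orth_proj ip (initial_span m) f) = norm c"
      by (simp add: f_def norm_smul)
    also have "\<dots> \<le> stability_bound (n + 1) powr (- \<gamma>) * R" by (rule c)
    also have "\<dots> \<le> stability_bound (m + 1) powr (- \<gamma>) * R"
    proof -
      have "stability_bound (m + 1) \<le> stability_bound (n + 1)"
        using True by (intro strict_mono_leD[OF stability_bound_strict_mono]) simp
      then show ?thesis
        using assms(2,3) stability_bound_ge_1[of "m + 1"]
        by (intro mult_right_mono powr_mono2') auto
    qed
    also have "\<dots> \<le> stability_bound (m + 1) powr (- \<gamma>) * R * norm f"
      using mult_left_mono[OF f1, of "stability_bound (m + 1) powr (- \<gamma>) * R"] assms(3) by simp
    finally show ?thesis .
  next
    case False
    have "f \<in> initial_span m"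
      unfolding f_def using False
      by (intro subspace_add subspace_scale subspace_initial_span e_in_initial_span) auto
    then have "orth_proj ip (initial_span m) f = f"
      by (intro orth_proj_eqI subspace_initial_span) auto
    then show ?thesis using assms(3) by simp
  qed
  then show "norm (e 0 + smul c (e n) - orth_proj ip (initial_span m) (e 0 + smul c (e n)))
      \<le> stability_bound (m + 1) powr (- \<gamma>) * R * norm (e 0 + smul c (e n))"
    by (simp add: f_def)
qed

text \<open>The difference has coefficients 1 - \<alpha> at \<open>e 0\<close> and (1 + \<alpha>) c
  at \<open>e n\<close>. Since 1 - \<alpha> and 1 + \<alpha> sum to 2, one of them has modulus at
  least 1.\<close>

lemma phase_dist_perturbation:
  assumes "n \<ge> 1" "norm c \<le> 1"
  shows "norm c \<le> phase_dist smul (e 0 + smul c (e n)) (e 0 + smul (- c) (e n))"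
proof (rule phase_dist_ge)
  fix \<alpha> :: 'k
  define d where "d = e 0 + smul c (e n) - smul \<alpha> (e 0 + smul (- c) (e n))"
  have "ip d (e 0) = 1 - \<alpha>" "ip d (e n) = (1 + \<alpha>) * c"
    using assms(1) by (auto simp: d_def ip_diff_left ip_add_left ip_smul_left ip_e algebra_simps)
  then have d: "norm (1 - \<alpha>) \<le> norm d" "norm (1 + \<alpha>) * norm c \<le> norm d"
    using norm_coefficient_le[of d 0] norm_coefficient_le[of d n] by (auto simp: norm_mult)
  have "2 \<le> norm (1 - \<alpha>) + norm (1 + \<alpha>)"
    using norm_triangle_ineq[of "1 - \<alpha>" "1 + \<alpha>"] by simp
  then consider "1 \<le> norm (1 - \<alpha>)" | "1 \<le> norm (1 + \<alpha>)" by linarith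
  then have "norm c \<le> norm d"
  proof cases
    case 1
    then show ?thesis using d(1) assms(2) by linarith
  next
    case 2
    then show ?thesis using d(2) mult_right_mono[OF 2, of "norm c"] by simp
  qed
  then show "norm c \<le> norm (e 0 + smul c (e n) - smul \<alpha> (e 0 + smul (- c) (e n)))"
    by (simp add: d_def)
qed

text \<open>The two vectors differ in the sign of coordinate n only. A frame vector that does not
  involve both coordinates 0 and n gives coefficients that agree or are negatives of each
  other.\<close>

lemma intensity_dist_perturbation:
  assumes "n \<ge> 1" "norm u = 1"
  shows "intensity_dist ip UNIV (pair_frame u) (e 0 + smul c (e n)) (e 0 + smul (- c) (e n))
    \<le> 4 * norm c * (1 / 2) ^ n"
proof -
  define f where "f = e 0 + smul c (e n)"
  define g where "g = e 0 + smul (- c) (e n)"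
  define D where "D i = (intensity ip (pair_frame u) f i - intensity ip (pair_frame u) g i)\<^sup>2" for i
  define T :: "(nat + nat \<times> nat \<times> bool) set"
    where "T = {Inr (0, n, True), Inr (0, n, False), Inr (n, 0, True), Inr (n, 0, False)}"
  have f: "ip f (e j) = of_bool (j = 0) + c * of_bool (j = n)" for j
    by (auto simp: f_def ip_add_left ip_smul_left ip_e)
  have g: "ip g (e j) = of_bool (j = 0) - c * of_bool (j = n)" for j
    by (auto simp: g_def ip_add_left ip_diff_left ip_smul_left ip_e)
  have zero: "D i = 0" if "i \<notin> T" for i
  proof (cases i)
    case (Inl j)
    then show ?thesis
      using assms(1) by (auto simp: D_def intensity_def pair_frame_def f g)
  next
    case (Inr jkb)
    obtain j k b where jkb: "jkb = (j, k, b)" by (cases jkb)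
    have "norm (ip f (e j) + v * ip f (e k)) = norm (ip g (e j) + v * ip g (e k))" for v
    proof -
      have "ip g (e j) + v * ip g (e k) = ip f (e j) + v * ip f (e k) \<or>
          ip g (e j) + v * ip g (e k) = - (ip f (e j) + v * ip f (e k))"
        using that assms(1) unfolding Inr jkb f g
        by (cases b; cases "j = n"; cases "k = n"; cases "j = 0"; cases "k = 0")
          (auto simp: T_def algebra_simps)
      then show ?thesis by (metis norm_minus_cancel)
    qed
    then show ?thesis
      by (simp add: D_def intensity_def pair_frame_def Inr jkb norm_ip_pair_vector)
  qed
  have bound: "D i \<le> (2 * norm c * (1 / 2) ^ n)\<^sup>2" if iT: "i \<in> T" for i
  proof -
    obtain j k b where i: "i = Inr (j, k, b)" and jk: "(j = 0 \<and> k = n) \<or> (j = n \<and> k = 0)"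
      using iT unfolding T_def by blast
    define v where "v = (if b then u else 1)"
    have v: "norm v = 1" using assms(2) by (simp add: v_def)
    have "(ip f (e j) + v * ip f (e k)) - (ip g (e j) + v * ip g (e k)) = (if j = 0 then v else 1) * (2 * c)"
      using jk assms(1) by (auto simp: f g algebra_simps)
    then have "norm ((ip f (e j) + v * ip f (e k)) - (ip g (e j) + v * ip g (e k))) = 2 * norm c"
      using v by (simp add: norm_mult)
    then have "\<bar>norm (ip f (e j) + v * ip f (e k)) - norm (ip g (e j) + v * ip g (e k))\<bar> \<le> 2 * norm c"
      by (metis norm_triangle_ineq3)
    moreover have "\<bar>intensity ip (pair_frame u) f i - intensity ip (pair_frame u) g i\<bar> =
        (1 / 2) ^ n * \<bar>norm (ip f (e j) + v * ip f (e k)) - norm (ip g (e j) + v * ip g (e k))\<bar>"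
    proof -
      have "max j k = n" using jk by auto
      then show ?thesis
        by (simp add: intensity_def pair_frame_def i norm_ip_pair_vector abs_mult v_def
            flip: right_diff_distrib)
    qed
    ultimately have "\<bar>intensity ip (pair_frame u) f i - intensity ip (pair_frame u) g i\<bar>
        \<le> 2 * norm c * (1 / 2) ^ n"
      by (simp add: mult.commute)
    then show ?thesis unfolding D_def using power_mono[OF _ abs_ge_zero, of _ _ 2] by force
  qed
  have "(\<Sum>\<^sub>\<infinity>i. D i) = (\<Sum>\<^sub>\<infinity>i\<in>T. D i)"
    by (rule infsum_cong_neutral) (auto simp: zero)
  also have "\<dots> = (\<Sum>i\<in>T. D i)" by (rule infsum_finite) (simp add: T_def)
  \<comment> \<open>Four terms contribute a factor sqrt 4 = 2, which makes the final constant
    4.\<close>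
  also have "\<dots> \<le> real (card T) * (2 * norm c * (1 / 2) ^ n)\<^sup>2"
    by (rule sum_bounded_above) (rule bound)
  also have "\<dots> = (4 * norm c * (1 / 2) ^ n)\<^sup>2"
    using assms(1) by (simp add: T_def power2_eq_square)
  finally have "sqrt (\<Sum>\<^sub>\<infinity>i. D i) \<le> 4 * norm c * (1 / 2) ^ n"
    by (intro real_le_lsqrt) simp_all
  then show ?thesis
    by (simp add: intensity_dist_def l2_norm_def D_def f_def g_def)
qed

text \<open>With q = 1/\<sigma>, the claim reduces to a constant times 2^(-(1-q) n) being below
  \<epsilon>^q, which is of order G^(-\<gamma> q). As G is 2^n up to a linear factor, the quotient
  decays like 2^(-t n) up to a power of n, and t > 0 says exactly \<sigma> > 1 + \<gamma>.\<close>

lemma holder_bound_violated: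
  assumes u: "norm u = 1" and "\<gamma> > 0" "R > 0" "\<sigma> > 1 + \<gamma>" "C > 0"
  shows "\<exists>f \<in> approx_class ip initial_span stability_bound \<gamma> R.
    \<exists>g \<in> approx_class ip initial_span stability_bound \<gamma> R.
      phase_dist smul f g > C * (norm f + norm g) powr (1 / \<sigma>)
        * intensity_dist ip UNIV (pair_frame u) f g powr ((\<sigma> - 1) / \<sigma>)"
proof -
  \<comment> \<open>This keeps \<epsilon> at most 1, for \<open>phase_dist_perturbation\<close>, and
    within the radius of the class.\<close>
  define a where "a = min 1 R"
  have a: "0 < a" "a \<le> 1" "a \<le> R" using assms(3) by (auto simp: a_def)
  define q where "q = 1 / \<sigma>"
  have q: "0 < q" "q < 1" "(\<sigma> - 1) / \<sigma> = 1 - q" using assms(2,4) by (auto simp: q_def field_simps)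
  define t where "t = 1 - q - \<gamma> * q"
  have "t = (\<sigma> - 1 - \<gamma>) / \<sigma>" using assms(2,4) by (simp add: t_def q_def field_simps)
  then have t: "t > 0" using assms(2,4) by simp
  have "(\<lambda>n. (18 * (real n + 1)) powr (\<gamma> * q) * 2 powr (- (t * real n))) \<longlonglongrightarrow> 0"
    using t by real_asymp
  moreover have "a powr q / (4 * C) > 0" using a assms(5) by simp
  ultimately have "eventually (\<lambda>n. (18 * (real n + 1)) powr (\<gamma> * q) * 2 powr (- (t * real n)) < a powr q / (4 * C)) sequentially"
    by (rule order_tendstoD(2))
  then have "eventually (\<lambda>n. n \<ge> 1 \<and> (18 * (real n + 1)) powr (\<gamma> * q) * 2 powr (- (t * real n)) < a powr q / (4 * C)) sequentially"
    using eventually_ge_at_top[of 1] by eventually_elim simp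
  then obtain n where n: "n \<ge> 1"
    and small: "(18 * (real n + 1)) powr (\<gamma> * q) * 2 powr (- (t * real n)) < a powr q / (4 * C)"
    using eventually_happens by force
  define G where "G = stability_bound (n + 1)"
  have G: "G \<ge> 1" "G = (18 * (real n + 1)) * 2 powr real n"
    using stability_bound_ge_1[of "n + 1"] by (simp_all add: G_def stability_bound_def powr_realpow)
  define \<epsilon> where "\<epsilon> = a * G powr (- \<gamma>)"
  have Gle: "G powr (- \<gamma>) \<le> 1" using G(1) assms(2) powr_mono[of "- \<gamma>" 0 G] by simp
  have \<epsilon>: "0 < \<epsilon>" "\<epsilon> \<le> 1" "\<epsilon> \<le> G powr (- \<gamma>) * R"
    using a G(1) Gle mult_mono[of a 1 "G powr (- \<gamma>)" 1] mult_right_mono[of a R "G powr (- \<gamma>)"]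
    by (auto simp: \<epsilon>_def mult.commute)
  define f where "f = e 0 + smul (of_real \<epsilon>) (e n)"
  define g where "g = e 0 + smul (- of_real \<epsilon>) (e n)"
  define \<delta> where "\<delta> = intensity_dist ip UNIV (pair_frame u) f g"
  have "f \<in> approx_class ip initial_span stability_bound \<gamma> R"
    unfolding f_def by (rule perturbation_in_approx_class[OF n assms(2,3)]) (use \<epsilon> in \<open>simp add: G_def\<close>)
  moreover have "g \<in> approx_class ip initial_span stability_bound \<gamma> R"
    unfolding g_def by (rule perturbation_in_approx_class[OF n assms(2,3)]) (use \<epsilon> in \<open>simp add: G_def\<close>)
  moreover have "C * (norm f + norm g) powr (1 / \<sigma>) * \<delta> powr ((\<sigma> - 1) / \<sigma>) < phase_dist smul f g"
  proof -
    have "norm f + norm g \<le> 4"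
      using norm_triangle_ineq[of "e 0" "smul (of_real \<epsilon>) (e n)"]
        norm_triangle_ineq[of "e 0" "smul (- of_real \<epsilon>) (e n)"] \<epsilon>
      by (simp add: f_def g_def norm_smul)
    moreover have "0 \<le> \<delta>" by (simp add: \<delta>_def intensity_dist_def l2_norm_def infsum_nonneg)
    moreover have "\<delta> \<le> 4 * \<epsilon> * (1 / 2) ^ n"
      using intensity_dist_perturbation[OF n u, of "of_real \<epsilon>"] \<epsilon>
      by (simp add: \<delta>_def f_def g_def)
    \<comment> \<open>The 4 bounding the norms and the 4 in the intensity bound occur with exponents
      q and 1 - q, so they merge into a single 4.\<close>
    ultimately have "C * (norm f + norm g) powr (1 / \<sigma>) * \<delta> powr ((\<sigma> - 1) / \<sigma>)
        \<le> C * 4 powr q * (4 * \<epsilon> * (1 / 2) ^ n) powr (1 - q)"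
      unfolding q(3) q_def[symmetric] using q(1,2) assms(5)
      by (intro mult_mono powr_mono2) (auto simp: q_def)
    also have "\<dots> = 4 * C * \<epsilon> powr (1 - q) * 2 powr (- ((1 - q) * real n))"
    proof -
      have "((1 / 2) ^ n :: real) = 2 powr (- real n)"
        by (simp add: powr_minus powr_realpow power_one_over field_simps)
      moreover have "(4::real) powr q * 4 powr (1 - q) = 4" by (simp flip: powr_add)
      ultimately show ?thesis
        using \<epsilon>(1) by (simp add: powr_mult powr_powr mult_ac)
    qed
    also have "\<dots> < \<epsilon> powr (1 - q) * \<epsilon> powr q"
    proof -
      have "2 powr (- ((1 - q) * real n)) * G powr (\<gamma> * q)
          = (18 * (real n + 1)) powr (\<gamma> * q) * 2 powr (- (t * real n))"
      proof -
        have "G powr (\<gamma> * q) = (18 * (real n + 1)) powr (\<gamma> * q) * 2 powr (real n * (\<gamma> * q))"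
          unfolding G(2) by (subst powr_mult) (simp_all add: powr_powr)
        moreover have "2 powr (- ((1 - q) * real n)) * 2 powr (real n * (\<gamma> * q)) = 2 powr (- (t * real n))"
          unfolding powr_add[symmetric] by (rule arg_cong) (simp add: t_def algebra_simps)
        ultimately show ?thesis by (metis mult.left_commute)
      qed
      then have "4 * C * (2 powr (- ((1 - q) * real n)) * G powr (\<gamma> * q)) < a powr q"
        using small assms(5) by (simp add: field_simps)
      then have "4 * C * 2 powr (- ((1 - q) * real n)) < a powr q * G powr (- (\<gamma> * q))"
        using G(1) by (simp add: powr_minus field_simps)
      also have "\<dots> = \<epsilon> powr q"
        using a G(1) by (simp add: \<epsilon>_def powr_mult powr_powr)
      finally show ?thesis using \<epsilon>(1) mult_strict_left_mono[of _ _ "\<epsilon> powr (1 - q)"]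
        by (simp add: mult_ac)
    qed
    also have "\<dots> = \<epsilon>" using \<epsilon>(1) by (simp flip: powr_add)
    also have "\<dots> \<le> phase_dist smul f g"
      using phase_dist_perturbation[OF n, of "of_real \<epsilon>"] \<epsilon> by (simp add: f_def g_def)
    finally show ?thesis .
  qed
  ultimately show ?thesis unfolding \<delta>_def by blast
qed

end

theorem theorem2p1:
  fixes smul :: "'k::rc_scalar \<Rightarrow> 'h::banach \<Rightarrow> 'h"
    and ip :: "'h \<Rightarrow> 'h \<Rightarrow> 'k"
  assumes hilbert: "hilbert_space smul ip"
    and separable: "\<exists>D::'h set. countable D \<and> closure D = UNIV"
    and infinite_dim: "\<not> (\<exists>Basis. finite_dimensional_vector_space smul Basis)"
  shows "\<exists>(V :: nat \<Rightarrow> 'h set) (\<phi> :: nat \<Rightarrow> 'h) (G :: nat \<Rightarrow> real).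
    (\<forall>m\<ge>1. module.subspace smul (V m) \<and> vector_space.dim smul (V m) = m
        \<and> V m \<subseteq> V (m + 1)) \<and>
    is_frame ip UNIV \<phi> \<and>
    (\<forall>m\<ge>1. G m > 0) \<and> strict_mono_on {1..} G \<and>
    (\<forall>m\<ge>1. \<forall>f\<in>V m. \<forall>g\<in>V m.
        phase_dist smul f g \<le> G m * intensity_dist ip UNIV \<phi> f g) \<and>
    (\<forall>\<gamma> R \<sigma> C. \<gamma> > 1 \<and> R > 0 \<and> \<sigma> > 1 + \<gamma> \<and> C > 0 \<longrightarrow>
        (\<exists>f \<in> approx_class ip V G \<gamma> R. \<exists>g \<in> approx_class ip V G \<gamma> R.
          phase_dist smul f g >
            C * (norm f + norm g) powr (1 / \<sigma>)
              * intensity_dist ip UNIV \<phi> f g powr ((\<sigma> - 1) / \<sigma>))) \<and>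
    (\<forall>\<gamma> R. \<gamma> > 1 \<and> R > 0 \<longrightarrow>
        \<not> lipschitz_stable_phase_retrieval smul ip UNIV \<phi> (approx_class ip V G \<gamma> R) \<and>
        (\<forall>\<sigma> > 1 + \<gamma>. \<not> holder_stable_phase_retrieval smul ip UNIV \<phi> ((\<sigma> - 1) / \<sigma>)
            (approx_class ip V G \<gamma> R)))"
proof -
  interpret hilbert_space smul ip by (rule hilbert)
  obtain e :: "nat \<Rightarrow> 'h" where e: "orthonormal e UNIV" "\<And>x. (\<And>i. ip x (e i) = 0) \<Longrightarrow> x = 0"
    using orthonormal_basis_exists[OF separable infinite_dim] by blast
  interpret complete_orthonormal_sequence smul ip e
    by unfold_locales (rule e, metis e(2))
  obtain u :: 'k where u: "norm u = 1"
    "\<And>z. 2 * norm z \<le> norm (z + scalar_cnj z) + norm (u * z + scalar_cnj (u * z))"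
    using polarizing_unit_exists by blast
  have "infinite (UNIV :: (nat + nat \<times> nat \<times> bool) set)" by simp
  then obtain h :: "nat \<Rightarrow> nat + nat \<times> nat \<times> bool" where h: "bij_betw h UNIV UNIV"
    by (metis countableE_infinite bij_betw_inv countableI_type)
  define \<phi> where "\<phi> = (\<lambda>n. pair_frame u (h n))"
  have dist: "intensity_dist ip UNIV \<phi> = intensity_dist ip UNIV (pair_frame u)"
    unfolding \<phi>_def by (intro ext intensity_dist_reindex h)
  have frame: "is_frame ip UNIV \<phi>"
    unfolding \<phi>_def by (rule is_frame_reindex[OF h is_frame_pair_frame[OF u(1)]])
  let ?B = "approx_class ip initial_span stability_bound"
  have violated: "\<exists>f \<in> ?B \<gamma> R. \<exists>g \<in> ?B \<gamma> R. phase_dist smul f g > C * (norm f + norm g) powr (1 / \<sigma>)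
      * intensity_dist ip UNIV \<phi> f g powr ((\<sigma> - 1) / \<sigma>)"
    if "\<gamma> > 1" "R > 0" "\<sigma> > 1 + \<gamma>" "C > 0" for \<gamma> R \<sigma> C
    unfolding dist using that by (intro holder_bound_violated u(1)) auto
  have not_holder: "\<not> holder_stable_phase_retrieval smul ip UNIV \<phi> ((\<sigma> - 1) / \<sigma>) (?B \<gamma> R)"
    if params: "\<gamma> > 1" "R > 0" "\<sigma> > 1 + \<gamma>" for \<gamma> R \<sigma>
  proof
    assume "holder_stable_phase_retrieval smul ip UNIV \<phi> ((\<sigma> - 1) / \<sigma>) (?B \<gamma> R)"
    moreover have "1 - (\<sigma> - 1) / \<sigma> = 1 / \<sigma>" using params by (simp add: field_simps)
    ultimately obtain K where K: "\<And>f g. f \<in> ?B \<gamma> R \<Longrightarrow> g \<in> ?B \<gamma> R \<Longrightarrow>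
        phase_dist smul f g \<le> K * (norm f + norm g) powr (1 / \<sigma>)
          * intensity_dist ip UNIV \<phi> f g powr ((\<sigma> - 1) / \<sigma>)"
      unfolding holder_stable_phase_retrieval_def by metis
    \<comment> \<open>The stability constant may be nonpositive, whereas \<open>violated\<close>
      asks for a positive one.\<close>
    have "max K 1 > 0" by simp
    from violated[OF params this] obtain f g where fg: "f \<in> ?B \<gamma> R" "g \<in> ?B \<gamma> R"
      "phase_dist smul f g > max K 1 * (norm f + norm g) powr (1 / \<sigma>)
          * intensity_dist ip UNIV \<phi> f g powr ((\<sigma> - 1) / \<sigma>)" by blast
    have "K * (norm f + norm g) powr (1 / \<sigma>) * intensity_dist ip UNIV \<phi> f g powr ((\<sigma> - 1) / \<sigma>)
        \<le> max K 1 * (norm f + norm g) powr (1 / \<sigma>) * intensity_dist ip UNIV \<phi> f g powr ((\<sigma> - 1) / \<sigma>)"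
      by (intro mult_right_mono) auto
    then show False using K[OF fg(1,2)] fg(3) by linarith
  qed
  have not_lipschitz: "\<not> lipschitz_stable_phase_retrieval smul ip UNIV \<phi> (?B \<gamma> R)"
    if "\<gamma> > 1" "R > 0" for \<gamma> R
  proof
    assume "lipschitz_stable_phase_retrieval smul ip UNIV \<phi> (?B \<gamma> R)"
    \<comment> \<open>A concrete \<sigma> = 2 + \<gamma> above the threshold; its exponent lies
      between 0 and 1.\<close>
    then have "holder_stable_phase_retrieval smul ip UNIV \<phi> (((2 + \<gamma>) - 1) / (2 + \<gamma>)) (?B \<gamma> R)"
      by (rule lipschitz_imp_holder_stable[OF frame]) (use that in auto)
    then show False using not_holder[OF that, of "2 + \<gamma>"] by simp
  qed
  have "(\<forall>m\<ge>1. subspace (initial_span m) \<and> dim (initial_span m) = m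
        \<and> initial_span m \<subseteq> initial_span (m + 1))"
    by (simp add: subspace_initial_span dim_initial_span initial_span_mono)
  moreover have "\<forall>m\<ge>1. stability_bound m > 0"
    using stability_bound_ge_1 by (meson less_le_trans zero_less_one)
  moreover have "strict_mono_on {1..} stability_bound"
    using stability_bound_strict_mono by (simp add: strict_mono_on_def strict_mono_def)
  moreover have "\<forall>m\<ge>1. \<forall>f\<in>initial_span m. \<forall>g\<in>initial_span m.
      phase_dist smul f g \<le> stability_bound m * intensity_dist ip UNIV \<phi> f g"
    unfolding dist using pair_frame_lipschitz_stable[OF u] by blast
  ultimately show ?thesis
    using frame violated not_holder not_lipschitz
    by (intro exI[of _ initial_span] exI[of _ \<phi>] exI[of _ stability_bound]) simp
qed

end
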